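(* Let $n\ge1$, let $\lambda=(\lambda_1,\ldots,\lambda_n)\in\mathbb{R}^n$ with $0<\lambda_1\le\cdots\le\lambda_n$, let $G_\lambda$ be the $\lambda$-oscillator group with Lie algebra $\mathfrak{g}_\lambda$, let $c\in\mathbb{R}$, and let $\circ$ be the bilinear product on $\mathfrak{g}_\lambda$ with $e_{-1}\circ e_{-1}=c\,e_0$ and all other products of basis elements zero. Let $\nabla^0$ and $\nabla$ be the left invariant linear connections on $G_\lambda$ given, for $u,v\in\mathfrak{g}_\lambda$, by $$\nabla^0_{u^\ell}v^\ell=\tfrac12[u^\ell,v^\ell],\qquad \nabla_{u^\ell}v^\ell=\nabla^0_{u^\ell}v^\ell+(u\circ v)^\ell .$$ Then $\nabla$ is bi-invariant, locally symmetric, and has the same curvature and the same holonomy algebra as $\nabla^0$. Moreover, in the coordinates $(t,s,x_j,y_j)_{j=1,\ldots,n}$, $\nabla$ is given by \begin{align*} \nabla_{\partial_t}\partial_{x_j}=\nabla_{\partial_{x_j}}\partial_t&=-\frac{\lambda_j}{2}\left(\frac12x_j\partial_s+\partial_{y_j}\right),\\ \nabla_{\partial_t}\partial_{y_j}=\nabla_{\partial_{y_j}}\partial_t&=-\frac{\lambda_j}{2}\left(\frac12y_j\partial_s-\partial_{x_j}\right),\\ \nabla_{\partial_t}\partial_t&=c\,\partial_s, \end{align*} for $j=1,\ldots,n$, and all the other Christoffel symbols vanish.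
   Context: The $\lambda$-oscillator group $G_\lambda$ is the Lie group with underlying manifold $\mathbb{R}^{2n+2}=\mathbb{R}\times\mathbb{R}\times\mathbb{C}^n$ and product $$(t,s,z).(t',s',z')=\Bigl(t+t',\,s+s'+\frac12\sum_{j=1}^n\mathrm{Im}\bigl[\bar z_j\exp(it\lambda_j)z'_j\bigr],\,\ldots,z_j+\exp(it\lambda_j)z'_j,\ldots\Bigr).$$ The coordinates are $(t,s,x_j,y_j)$ with $z_j=x_j+iy_j$. Its Lie algebra $\mathfrak{g}_\lambda$ (the tangent space at the identity, $\mathbb{R}\times\mathbb{R}\times\mathbb{C}^n$) has basis $e_{-1}=(1,0,0)$, $e_0=(0,1,0)$, $e_j=(0,0,(0,\ldots,1,\ldots,0))$, $\check e_j=(0,0,(0,\ldots,i,\ldots,0))$ (with entry in position $j$), with brackets $[e_{-1},e_j]=\lambda_j\check e_j$, $[e_{-1},\check e_j]=-\lambda_je_j$, $[e_j,\check e_j]=e_0$, the unspecified ones being given by antisymmetry or zero. For $u\in\mathfrak{g}_\lambda$, $u^\ell$ is the left invariant vector field on $G_\lambda$ associated to $u$. A linear connection is bi-invariant if it is invariant under all left and right translations; locally symmetric means torsion free with parallel curvature tensor. *)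

theory Defs
  imports "HOL-Analysis.Analysis" "HOL-Algebra.Group"
begin

section \<open>Vector fields and linear connections on a manifold with a global chart\<close>

text \<open>
  The manifold is a Euclidean space, so vector fields are functions \<open>'a \<Rightarrow> 'a\<close>, and the
  coordinate vector fields are the constant ones.
\<close>

primrec C_k :: "nat \<Rightarrow> ('a::euclidean_space \<Rightarrow> 'b::euclidean_space) \<Rightarrow> bool" where
  "C_k 0 = (\<lambda>f. continuous_on UNIV f)"
| "C_k (Suc k) = (\<lambda>f. (\<forall>x. f differentiable (at x)) \<and>
                        (\<forall>v. C_k k (\<lambda>x. frechet_derivative f (at x) v)))"

definition smooth :: "('a::euclidean_space \<Rightarrow> 'b::euclidean_space) \<Rightarrow> bool" where
  "smooth f \<longleftrightarrow> (\<forall>k. C_k k f)"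

type_synonym 'a vfield = "'a \<Rightarrow> 'a"
type_synonym 'a connection = "'a vfield \<Rightarrow> 'a vfield \<Rightarrow> 'a vfield"

definition vf_bracket :: "'a::euclidean_space vfield \<Rightarrow> 'a vfield \<Rightarrow> 'a vfield" where
  "vf_bracket X Y = (\<lambda>p. frechet_derivative Y (at p) (X p) - frechet_derivative X (at p) (Y p))"

text \<open>
  A linear connection is an operator on smooth vector fields; its values on non-smooth arguments
  carry no meaning and are left unconstrained.
\<close>

definition linear_connection :: "'a::euclidean_space connection \<Rightarrow> bool" where
  "linear_connection D \<longleftrightarrow>
     (\<forall>X Y. smooth X \<longrightarrow> smooth Y \<longrightarrow> smooth (D X Y)) \<and>
     (\<forall>X X' Y. smooth X \<longrightarrow> smooth X' \<longrightarrow> smooth Y \<longrightarrow>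
        D (\<lambda>p. X p + X' p) Y = (\<lambda>p. D X Y p + D X' Y p)) \<and>
     (\<forall>X Y Y'. smooth X \<longrightarrow> smooth Y \<longrightarrow> smooth Y' \<longrightarrow>
        D X (\<lambda>p. Y p + Y' p) = (\<lambda>p. D X Y p + D X Y' p)) \<and>
     (\<forall>(f :: 'a \<Rightarrow> real) X Y. smooth f \<longrightarrow> smooth X \<longrightarrow> smooth Y \<longrightarrow>
        D (\<lambda>p. f p *\<^sub>R X p) Y = (\<lambda>p. f p *\<^sub>R D X Y p)) \<and>
     (\<forall>(f :: 'a \<Rightarrow> real) X Y. smooth f \<longrightarrow> smooth X \<longrightarrow> smooth Y \<longrightarrow>
        D X (\<lambda>p. f p *\<^sub>R Y p) =
          (\<lambda>p. frechet_derivative f (at p) (X p) *\<^sub>R Y p + f p *\<^sub>R D X Y p))"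

definition torsion :: "'a::euclidean_space connection \<Rightarrow> 'a vfield \<Rightarrow> 'a vfield \<Rightarrow> 'a vfield" where
  "torsion D X Y = (\<lambda>p. D X Y p - D Y X p - vf_bracket X Y p)"

definition curvature ::
    "'a::euclidean_space connection \<Rightarrow> 'a vfield \<Rightarrow> 'a vfield \<Rightarrow> 'a vfield \<Rightarrow> 'a vfield" where
  "curvature D X Y Z = (\<lambda>p. D X (D Y Z) p - D Y (D X Z) p - D (vf_bracket X Y) Z p)"

definition torsion_free :: "'a::euclidean_space connection \<Rightarrow> bool" where
  "torsion_free D \<longleftrightarrow> (\<forall>X Y. smooth X \<longrightarrow> smooth Y \<longrightarrow> torsion D X Y = (\<lambda>p. 0))"

definition parallel_curvature :: "'a::euclidean_space connection \<Rightarrow> bool" where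
  "parallel_curvature D \<longleftrightarrow>
     (\<forall>W X Y Z. smooth W \<longrightarrow> smooth X \<longrightarrow> smooth Y \<longrightarrow> smooth Z \<longrightarrow>
        (\<forall>p. D W (curvature D X Y Z) p - curvature D (D W X) Y Z p
              - curvature D X (D W Y) Z p - curvature D X Y (D W Z) p = 0))"

definition locally_symmetric :: "'a::euclidean_space connection \<Rightarrow> bool" where
  "locally_symmetric D \<longleftrightarrow> torsion_free D \<and> parallel_curvature D"

definition same_curvature :: "'a::euclidean_space connection \<Rightarrow> 'a connection \<Rightarrow> bool" where
  "same_curvature D D' \<longleftrightarrow>
     (\<forall>X Y Z. smooth X \<longrightarrow> smooth Y \<longrightarrow> smooth Z \<longrightarrow> curvature D X Y Z = curvature D' X Y Z)"

section \<open>Holonomy\<close>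

definition christoffel :: "'a::euclidean_space connection \<Rightarrow> 'a \<Rightarrow> 'a \<Rightarrow> 'a \<Rightarrow> 'a" where
  "christoffel D p u v = D (\<lambda>q. u) (\<lambda>q. v) p"

text \<open>Derivatives within \<open>{a..b}\<close> are one-sided at the end points.\<close>

definition C1_segment :: "(real \<Rightarrow> 'a::euclidean_space) \<Rightarrow> real \<Rightarrow> real \<Rightarrow> bool" where
  "C1_segment \<gamma> a b \<longleftrightarrow>
     (\<forall>t\<in>{a..b}. \<gamma> differentiable (at t within {a..b})) \<and>
     continuous_on {a..b} (\<lambda>t. vector_derivative \<gamma> (at t within {a..b}))"

definition parallel_along ::
    "'a::euclidean_space connection \<Rightarrow> (real \<Rightarrow> 'a) \<Rightarrow> (real \<Rightarrow> 'a) \<Rightarrow> real \<Rightarrow> real \<Rightarrow> bool" where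
  "parallel_along D \<gamma> V a b \<longleftrightarrow>
     (\<forall>t\<in>{a..b}. (V has_vector_derivative
          - christoffel D (\<gamma> t) (vector_derivative \<gamma> (at t within {a..b})) (V t))
        (at t within {a..b}))"

definition unit_partition :: "nat \<Rightarrow> (nat \<Rightarrow> real) \<Rightarrow> bool" where
  "unit_partition m \<tau> \<longleftrightarrow> \<tau> 0 = 0 \<and> \<tau> m = 1 \<and> (\<forall>i<m. \<tau> i < \<tau> (Suc i))"

text \<open>
  The parallel transports at \<open>p\<close> along piecewise \<open>C\<^sup>1\<close> loops. The field \<open>V\<close> is continuous,
  since consecutive segments share their end point.
\<close>

definition holonomy_group :: "'a::euclidean_space connection \<Rightarrow> 'a \<Rightarrow> ('a \<Rightarrow> 'a) set" where
  "holonomy_group D p =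
     {P. linear P \<and>
         (\<exists>\<gamma> m \<tau>. unit_partition m \<tau> \<and> (\<forall>i<m. C1_segment \<gamma> (\<tau> i) (\<tau> (Suc i))) \<and>
             \<gamma> 0 = p \<and> \<gamma> 1 = p \<and>
             (\<forall>v. \<exists>V. V 0 = v \<and> V 1 = P v \<and>
                (\<forall>i<m. parallel_along D \<gamma> V (\<tau> i) (\<tau> (Suc i)))))}"

definition endo_exp :: "('a::euclidean_space \<Rightarrow> 'a) \<Rightarrow> 'a \<Rightarrow> 'a" where
  "endo_exp A v = (\<Sum>k. (1 / fact k) *\<^sub>R (A ^^ k) v)"

text \<open>The Lie algebra of the Lie group \<open>holonomy_group D p\<close>, inside the endomorphisms of the
  tangent space at \<open>p\<close>.\<close>

definition holonomy_algebra :: "'a::euclidean_space connection \<Rightarrow> 'a \<Rightarrow> ('a \<Rightarrow> 'a) set" where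
  "holonomy_algebra D p =
     {A. linear A \<and> (\<forall>s::real. endo_exp (\<lambda>v. s *\<^sub>R A v) \<in> holonomy_group D p)}"

section \<open>Invariance on a Lie group with a global chart\<close>

definition pushforward :: "('a::euclidean_space \<Rightarrow> 'a) \<Rightarrow> 'a vfield \<Rightarrow> 'a vfield" where
  "pushforward \<phi> X = (\<lambda>q. frechet_derivative \<phi> (at (inv_into UNIV \<phi> q)) (X (inv_into UNIV \<phi> q)))"

definition invariant_under :: "('a::euclidean_space \<Rightarrow> 'a) \<Rightarrow> 'a connection \<Rightarrow> bool" where
  "invariant_under \<phi> D \<longleftrightarrow>
     (\<forall>X Y. smooth X \<longrightarrow> smooth Y \<longrightarrow>
        pushforward \<phi> (D X Y) = D (pushforward \<phi> X) (pushforward \<phi> Y))"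

definition left_invariant :: "'a::euclidean_space monoid \<Rightarrow> 'a connection \<Rightarrow> bool" where
  "left_invariant G D \<longleftrightarrow> (\<forall>a\<in>carrier G. invariant_under (\<lambda>g. a \<otimes>\<^bsub>G\<^esub> g) D)"

definition right_invariant :: "'a::euclidean_space monoid \<Rightarrow> 'a connection \<Rightarrow> bool" where
  "right_invariant G D \<longleftrightarrow> (\<forall>a\<in>carrier G. invariant_under (\<lambda>g. g \<otimes>\<^bsub>G\<^esub> a) D)"

definition bi_invariant :: "'a::euclidean_space monoid \<Rightarrow> 'a connection \<Rightarrow> bool" where
  "bi_invariant G D \<longleftrightarrow> left_invariant G D \<and> right_invariant G D"

definition left_inv_field :: "'a::euclidean_space monoid \<Rightarrow> 'a \<Rightarrow> 'a vfield" where
  "left_inv_field G u = (\<lambda>p. frechet_derivative (\<lambda>g. p \<otimes>\<^bsub>G\<^esub> g) (at \<one>\<^bsub>G\<^esub>) u)"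

section \<open>The oscillator group\<close>

text \<open>
  The index type \<open>'n\<close> of a finite linear order plays the role of \<open>{1, \<dots>, n}\<close>, so that
  \<open>n = CARD('n) \<ge> 1\<close>. Both the group and its Lie algebra live on \<open>real \<times> real \<times> (complex ^ 'n)\<close>.
\<close>

type_synonym 'n osc = "real \<times> real \<times> (complex ^ 'n)"

definition osc_mult :: "real ^ 'n::finite \<Rightarrow> 'n osc \<Rightarrow> 'n osc \<Rightarrow> 'n osc" where
  "osc_mult lam = (\<lambda>(t, s, z) (t', s', z').
     (t + t',
      s + s' + 1/2 * (\<Sum>j\<in>UNIV. Im (cnj (z $ j) * exp (\<i> * complex_of_real (t * lam $ j)) * z' $ j)),
      \<chi> j. z $ j + exp (\<i> * complex_of_real (t * lam $ j)) * z' $ j))"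

definition osc_group :: "real ^ 'n::finite \<Rightarrow> 'n osc monoid" where
  "osc_group lam = \<lparr>carrier = UNIV, mult = osc_mult lam, one = (0, 0, 0)\<rparr>"

definition e_m1 :: "'n::finite osc" where "e_m1 = (1, 0, 0)"
definition e_0 :: "'n::finite osc" where "e_0 = (0, 1, 0)"
definition e_re :: "'n \<Rightarrow> 'n::finite osc" where "e_re j = (0, 0, axis j 1)"
definition e_im :: "'n \<Rightarrow> 'n::finite osc" where "e_im j = (0, 0, axis j \<i>)"

definition osc_basis :: "('n::finite osc) set" where
  "osc_basis = {e_m1, e_0} \<union> range e_re \<union> range e_im"

text \<open>The coordinate vector fields for \<open>(t, s, x\<^sub>j, y\<^sub>j)\<close> with \<open>z\<^sub>j = x\<^sub>j + i y\<^sub>j\<close>.\<close>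

definition d_t :: "('n::finite osc) vfield" where "d_t = (\<lambda>p. e_m1)"
definition d_s :: "('n::finite osc) vfield" where "d_s = (\<lambda>p. e_0)"
definition d_x :: "'n \<Rightarrow> ('n::finite osc) vfield" where "d_x j = (\<lambda>p. e_re j)"
definition d_y :: "'n \<Rightarrow> ('n::finite osc) vfield" where "d_y j = (\<lambda>p. e_im j)"

definition coord_fields :: "('n::finite osc) vfield set" where
  "coord_fields = {d_t, d_s} \<union> range d_x \<union> range d_y"

definition x_coord :: "'n \<Rightarrow> 'n::finite osc \<Rightarrow> real" where "x_coord j = (\<lambda>(t, s, z). Re (z $ j))"
definition y_coord :: "'n \<Rightarrow> 'n::finite osc \<Rightarrow> real" where "y_coord j = (\<lambda>(t, s, z). Im (z $ j))"

end

(* In a global chart a linear connection is Y \<mapsto> dY + \<Gamma>(\<cdot>, Y) with Christoffel symbols \<Gamma>. The values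
   on the left invariant frame determine \<Gamma>: with B = t(u) z(v) + t(v) z(u) and J = i lam,
   \<Gamma>_p(u, v) = (0, c t(u) t(v) - 1/4 \<omega>(z(p), J B), - 1/2 J B).
   Torsion, curvature and its covariant derivative, and invariance under a diffeomorphism are then
   pointwise identities that follow from bilinearity, the skewness of \<omega> and \<omega>(J x, y) = - \<omega>(x, J y).
   The term with c takes values in the central direction and depends only on time components; it
   therefore does not contribute to the curvature, and changing c changes a parallel field V along
   \<gamma> by a multiple of (t(\<gamma>) - t(\<gamma>(0))) t(V) e_0, which is 0 at the end of a loop. *)
theory Submission
  imports Defs
begin

section \<open>Smooth functions\<close>

text \<open>A connection is only an operator on smooth fields, so each use of its axioms needs a
  smoothness certificate; hence the calculus of \<open>smooth\<close>. Curvature applies the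
  connection twice, which calls for the symmetry of second derivatives. The Christoffel symbols
  arise as follows. For tangent vectors u, v at p take the left invariant fields U, V through them.
  The defining formula reads (dV(u) - dU(v))/2 + c t(u) t(v) e_0 = dV(u) + \<Gamma>_p(u, v), so
  \<Gamma>_p(u, v) = c t(u) t(v) e_0 - (dV(u) + dU(v))/2. This is symmetric in u and v, and the
  contributions \<omega>(z(u), z(v)) and \<omega>(z(v), z(u)) of the two derivatives cancel. The
  scalar c stays a parameter throughout: \<open>nabla0\<close> is the case c = 0, so one computation
  serves both connections. The extra term is dt \<otimes> dt \<otimes> e_0; translations on either
  side preserve both dt and e_0, which is why it respects bi-invariance.\<close>

lemma C_k_SucD: "C_k (Suc k) f \<Longrightarrow> C_k k f"
proof (induction k arbitrary: f)
  case 0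
  then show ?case
    by (simp add: continuous_at_imp_continuous_on differentiable_imp_continuous_within)
next
  case (Suc k)
  then show ?case by (metis C_k.simps(2))
qed

lemma frechet_derivative_eqI: "(f has_derivative f') (at x) \<Longrightarrow> frechet_derivative f (at x) = f'"
  by (metis frechet_derivative_at)

text \<open>Together with \<open>C_k_SucE\<close> this replaces unfolding \<open>C_k\<close>: any
  explicitly known derivative may stand for \<open>frechet_derivative\<close>.\<close>

lemma C_k_SucI:
  assumes "\<And>x. (f has_derivative f' x) (at x)" "\<And>v. C_k k (\<lambda>x. f' x v)"
  shows "C_k (Suc k) f"
  using assms by (auto simp: frechet_derivative_eqI[OF assms(1)] intro: differentiableI)

lemma C_k_SucE:
  assumes "C_k (Suc k) f"
  shows "(f has_derivative frechet_derivative f (at x)) (at x)" "C_k k (\<lambda>x. frechet_derivative f (at x) v)"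
  using assms by (auto simp: frechet_derivative_works)

lemma C_k_const: "C_k k (\<lambda>x. c)"
  by (induction k arbitrary: c) (auto simp del: C_k.simps(2) intro!: C_k_SucI derivative_eq_intros)

lemma C_k_bounded_linear:
  assumes "bounded_linear L"
  shows "C_k k f \<Longrightarrow> C_k k (\<lambda>x. L (f x))"
proof (induction k arbitrary: f)
  case 0
  then show ?case using assms by (simp add: linear_continuous_on_compose linear_linear)
next
  case (Suc k)
  show ?case
    by (rule C_k_SucI[OF bounded_linear.has_derivative[OF assms C_k_SucE(1)[OF Suc.prems]]])
      (rule Suc.IH[OF C_k_SucE(2)[OF Suc.prems]])
qed

lemma C_k_add: "C_k k f \<Longrightarrow> C_k k g \<Longrightarrow> C_k k (\<lambda>x. f x + g x)"
proof (induction k arbitrary: f g)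
  case 0
  then show ?case by (simp add: continuous_on_add)
next
  case (Suc k)
  show ?case
    by (rule C_k_SucI[OF has_derivative_add[OF C_k_SucE(1)[OF Suc.prems(1)] C_k_SucE(1)[OF Suc.prems(2)]]])
      (rule Suc.IH[OF C_k_SucE(2)[OF Suc.prems(1)] C_k_SucE(2)[OF Suc.prems(2)]])
qed

lemma C_k_sum: "(\<And>i. i \<in> I \<Longrightarrow> C_k k (f i)) \<Longrightarrow> C_k k (\<lambda>x. \<Sum>i\<in>I. f i x)"
  by (induction I rule: infinite_finite_induct) (auto simp: C_k_const C_k_add)

lemma C_k_bounded_bilinear:
  assumes "bounded_bilinear B"
  shows "C_k k f \<Longrightarrow> C_k k g \<Longrightarrow> C_k k (\<lambda>x. B (f x) (g x))"
proof (induction k arbitrary: f g)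
  case 0
  then show ?case using bounded_bilinear.continuous_on[OF assms] by auto
next
  case (Suc k)
  note bounded_bilinear.FDERIV[OF assms C_k_SucE(1)[OF Suc.prems(1)] C_k_SucE(1)[OF Suc.prems(2)]]
  then show ?case
    by (rule C_k_SucI)
      (intro C_k_add Suc.IH C_k_SucE(2)[OF Suc.prems(1)] C_k_SucE(2)[OF Suc.prems(2)]
        C_k_SucD[OF Suc.prems(1)] C_k_SucD[OF Suc.prems(2)])
qed

text \<open>\<open>C_k\<close> controls derivatives only in fixed directions. This expansion trades
  a direction that varies with the point for fixed ones with scalar coefficients.\<close>

lemma linear_Basis_expansion:
  fixes L :: "'a::euclidean_space \<Rightarrow> 'b::real_vector"
  assumes "linear L"
  shows "L v = (\<Sum>b\<in>Basis. (v \<bullet> b) *\<^sub>R L b)"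
proof -
  have "L v = L (\<Sum>b\<in>Basis. (v \<bullet> b) *\<^sub>R b)" by (simp add: euclidean_representation)
  then show ?thesis by (simp only: linear_sum[OF assms] linear_scale[OF assms])
qed

text \<open>In the chain rule both the base point and the direction of the derivative of f move. The
  expansion in \<open>Basis\<close> separates them, and the induction hypothesis applies to each
  partial derivative of f composed with g.\<close>

lemma C_k_compose: "C_k k f \<Longrightarrow> C_k k g \<Longrightarrow> C_k k (\<lambda>x. f (g x))"
proof (induction k arbitrary: f g)
  case 0
  then show ?case using continuous_on_compose2[of UNIV f UNIV g] by auto
next
  case (Suc k)
  have lin: "linear (frechet_derivative f (at y))" for y
    using C_k_SucE(1)[OF Suc.prems(1)] has_derivative_linear by blast
  show ?case
  proof (rule C_k_SucI)
    fix x
    show "((\<lambda>x. f (g x)) has_derivative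
      (\<lambda>v. frechet_derivative f (at (g x)) (frechet_derivative g (at x) v))) (at x)"
      using diff_chain_at[OF C_k_SucE(1)[OF Suc.prems(2)] C_k_SucE(1)[OF Suc.prems(1)]]
      by (simp add: o_def)
  next
    fix v
    show "C_k k (\<lambda>x. frechet_derivative f (at (g x)) (frechet_derivative g (at x) v))"
      by (subst linear_Basis_expansion[OF lin]) (intro C_k_sum C_k_bounded_bilinear[OF bounded_bilinear_scaleR] Suc.IH
          C_k_bounded_linear[OF bounded_linear_inner_left]
          C_k_SucE(2)[OF Suc.prems(1)] C_k_SucE(2)[OF Suc.prems(2)] C_k_SucD[OF Suc.prems(2)])
  qed
qed

lemma smooth_const: "smooth (\<lambda>x. c)"
  by (simp add: smooth_def C_k_const)

lemma smooth_compose_bounded_linear: "bounded_linear L \<Longrightarrow> smooth f \<Longrightarrow> smooth (\<lambda>x. L (f x))"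
  by (simp add: smooth_def C_k_bounded_linear)

lemma smooth_add: "smooth f \<Longrightarrow> smooth g \<Longrightarrow> smooth (\<lambda>x. f x + g x)"
  by (simp add: smooth_def C_k_add)

lemma smooth_sum: "(\<And>i. i \<in> I \<Longrightarrow> smooth (f i)) \<Longrightarrow> smooth (\<lambda>x. \<Sum>i\<in>I. f i x)"
  by (simp add: smooth_def C_k_sum)

lemma smooth_bounded_bilinear:
  "bounded_bilinear B \<Longrightarrow> smooth f \<Longrightarrow> smooth g \<Longrightarrow> smooth (\<lambda>x. B (f x) (g x))"
  by (simp add: smooth_def C_k_bounded_bilinear)

lemma smooth_compose: "smooth f \<Longrightarrow> smooth g \<Longrightarrow> smooth (\<lambda>x. f (g x))"
  by (simp add: smooth_def C_k_compose)

lemma smooth_scaleR: "smooth f \<Longrightarrow> smooth g \<Longrightarrow> smooth (\<lambda>x. f x *\<^sub>R g x)"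
  by (rule smooth_bounded_bilinear[OF bounded_bilinear_scaleR])

lemma smooth_inner_left: "smooth f \<Longrightarrow> smooth (\<lambda>x. f x \<bullet> b)"
  by (rule smooth_compose_bounded_linear[OF bounded_linear_inner_left])

lemma smooth_diff: "smooth f \<Longrightarrow> smooth g \<Longrightarrow> smooth (\<lambda>x. f x - g x)"
  using smooth_add[of f "\<lambda>x. - g x"] smooth_compose_bounded_linear[OF bounded_linear_minus[OF bounded_linear_ident], of g]
  by simp

lemma smooth_has_derivative:
  "smooth f \<Longrightarrow> (f has_derivative frechet_derivative f (at x)) (at x)"
  using C_k_SucE(1) unfolding smooth_def by blast

lemma smooth_linear_derivative: "smooth f \<Longrightarrow> linear (frechet_derivative f (at x))"
  using smooth_has_derivative has_derivative_linear by blast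

lemma smooth_frechet_derivative: "smooth f \<Longrightarrow> smooth (\<lambda>x. frechet_derivative f (at x) v)"
  using C_k_SucE(2) unfolding smooth_def by blast

lemma smooth_derivative_apply:
  assumes "smooth f" "smooth g" "smooth h"
  shows "smooth (\<lambda>x. frechet_derivative f (at (g x)) (h x))"
  by (subst linear_Basis_expansion[OF smooth_linear_derivative[OF assms(1)]]) (intro smooth_sum smooth_scaleR smooth_inner_left assms
      smooth_compose[OF smooth_frechet_derivative assms(2)])

lemma smooth_continuous: "smooth f \<Longrightarrow> continuous_on UNIV f"
  by (metis C_k.simps(1) smooth_def)

lemma smooth_ident: "smooth (\<lambda>x::'a::euclidean_space. x)"
  unfolding smooth_def
proof
  fix k show "C_k k (\<lambda>x::'a. x)"
    by (cases k) (auto simp: C_k_const simp del: C_k.simps(2) intro!: C_k_SucI[OF has_derivative_ident])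
qed

section \<open>Symmetry of second derivatives\<close>

lemma second_difference_mean_value:
  fixes f :: "'a::real_normed_vector \<Rightarrow> real"
  assumes f': "\<And>x. (f has_derivative f' x) (at x)"
    and f'': "\<And>x. ((\<lambda>y. f' y u) has_derivative f'' x) (at x)"
    and "0 < h"
  shows "\<exists>a b. 0 < a \<and> a < h \<and> 0 < b \<and> b < h \<and>
    f (x + h *\<^sub>R u + h *\<^sub>R v) - f (x + h *\<^sub>R u) - f (x + h *\<^sub>R v) + f x = h * h * f'' (x + a *\<^sub>R u + b *\<^sub>R v) v"
proof -
  have lin: "linear (f' y)" "linear (f'' y)" for y
    using f' f'' has_derivative_linear by blast+
  \<comment> \<open>The second difference is the increment over [0, h] of this function of s. One
    mean value theorem in direction u leaves an increment of \<open>f' _ u\<close> in direction v,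
    and a second one finishes.\<close>
  have 1: "((\<lambda>s. f (x + s *\<^sub>R u + h *\<^sub>R v) - f (x + s *\<^sub>R u)) has_real_derivative
      f' (x + s *\<^sub>R u + h *\<^sub>R v) u - f' (x + s *\<^sub>R u) u) (at s)" for s
  proof -
    have "((\<lambda>s. x + s *\<^sub>R u + h *\<^sub>R v) has_derivative (\<lambda>d. d *\<^sub>R u)) (at s)"
      "((\<lambda>s. x + s *\<^sub>R u) has_derivative (\<lambda>d. d *\<^sub>R u)) (at s)"
      by (auto intro!: derivative_eq_intros)
    from has_derivative_diff[OF this[THEN has_derivative_compose[OF _ f']]] show ?thesis
      unfolding has_field_derivative_def
      by (rule has_derivative_eq_rhs) (auto simp: fun_eq_iff linear_scale[OF lin(1)] algebra_simps)
  qed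
  obtain a where a: "0 < a" "a < h"
    "f (x + h *\<^sub>R u + h *\<^sub>R v) - f (x + h *\<^sub>R u) - (f (x + 0 *\<^sub>R u + h *\<^sub>R v) - f (x + 0 *\<^sub>R u)) =
      (h - 0) * (f' (x + a *\<^sub>R u + h *\<^sub>R v) u - f' (x + a *\<^sub>R u) u)"
    using MVT2[OF \<open>0 < h\<close> 1] by blast
  have 2: "((\<lambda>t. f' (x + a *\<^sub>R u + t *\<^sub>R v) u) has_real_derivative f'' (x + a *\<^sub>R u + t *\<^sub>R v) v) (at t)" for t
  proof -
    have "((\<lambda>t. x + a *\<^sub>R u + t *\<^sub>R v) has_derivative (\<lambda>d. d *\<^sub>R v)) (at t)"
      by (auto intro!: derivative_eq_intros)
    from has_derivative_compose[OF this f''] show ?thesis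
      unfolding has_field_derivative_def
      by (rule has_derivative_eq_rhs) (auto simp: fun_eq_iff linear_scale[OF lin(2)])
  qed
  obtain b where "0 < b" "b < h"
    "f' (x + a *\<^sub>R u + h *\<^sub>R v) u - f' (x + a *\<^sub>R u + 0 *\<^sub>R v) u = (h - 0) * f'' (x + a *\<^sub>R u + b *\<^sub>R v) v"
    using MVT2[OF \<open>0 < h\<close> 2] by blast
  with a show ?thesis by (intro exI[of _ a] exI[of _ b]) auto
qed

text \<open>The second difference is symmetric in u and v. Divided by the squared step it equals
  either mixed derivative at a nearby point, and continuity moves both points to x.\<close>

lemma second_derivative_symmetric_real:
  fixes f :: "'a::real_normed_vector \<Rightarrow> real"
  assumes f': "\<And>x. (f has_derivative f' x) (at x)"
    and fu: "\<And>x. ((\<lambda>y. f' y u) has_derivative fu x) (at x)"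
    and fv: "\<And>x. ((\<lambda>y. f' y v) has_derivative fv x) (at x)"
    and cu: "continuous_on UNIV (\<lambda>x. fu x v)" and cv: "continuous_on UNIV (\<lambda>x. fv x u)"
  shows "fu x v = fv x u"
proof -
  define h where "h n = inverse (real (Suc n))" for n
  have hpos: "0 < h n" for n by (simp add: h_def)
  have hlim: "h \<longlonglongrightarrow> 0" unfolding h_def by (rule LIMSEQ_inverse_real_of_nat)
  obtain a b :: "nat \<Rightarrow> real" where ab: "\<And>n. 0 < a n \<and> a n < h n \<and> 0 < b n \<and> b n < h n \<and>
    f (x + h n *\<^sub>R u + h n *\<^sub>R v) - f (x + h n *\<^sub>R u) - f (x + h n *\<^sub>R v) + f x
      = h n * h n * fu (x + a n *\<^sub>R u + b n *\<^sub>R v) v"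
    using second_difference_mean_value[OF f' fu hpos, where x = x and v = v] by metis
  obtain a' b' :: "nat \<Rightarrow> real" where ab': "\<And>n. 0 < a' n \<and> a' n < h n \<and> 0 < b' n \<and> b' n < h n \<and>
    f (x + h n *\<^sub>R v + h n *\<^sub>R u) - f (x + h n *\<^sub>R v) - f (x + h n *\<^sub>R u) + f x
      = h n * h n * fv (x + a' n *\<^sub>R v + b' n *\<^sub>R u) u"
    using second_difference_mean_value[OF f' fv hpos, where x = x and v = u] by metis
  have lim0: "g \<longlonglongrightarrow> 0" if "\<And>n. 0 < g n \<and> g n < h n" for g
    by (rule tendsto_sandwich[OF _ _ tendsto_const hlim]) (use that in \<open>auto intro!: always_eventually less_imp_le\<close>)
  have lims: "a \<longlonglongrightarrow> 0" "b \<longlonglongrightarrow> 0" "a' \<longlonglongrightarrow> 0" "b' \<longlonglongrightarrow> 0"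
    using lim0 ab ab' by blast+
  have "(\<lambda>n. x + a n *\<^sub>R u + b n *\<^sub>R v) \<longlonglongrightarrow> x" "(\<lambda>n. x + a' n *\<^sub>R v + b' n *\<^sub>R u) \<longlonglongrightarrow> x"
    by (auto intro!: tendsto_eq_intros lims)
  then have "(\<lambda>n. fu (x + a n *\<^sub>R u + b n *\<^sub>R v) v) \<longlonglongrightarrow> fu x v"
    "(\<lambda>n. fv (x + a' n *\<^sub>R v + b' n *\<^sub>R u) u) \<longlonglongrightarrow> fv x u"
    using continuous_on_tendsto_compose[OF cu] continuous_on_tendsto_compose[OF cv] by auto
  moreover have "fu (x + a n *\<^sub>R u + b n *\<^sub>R v) v = fv (x + a' n *\<^sub>R v + b' n *\<^sub>R u) u" for n
  proof -
    have "f (x + h n *\<^sub>R u + h n *\<^sub>R v) = f (x + h n *\<^sub>R v + h n *\<^sub>R u)" by (simp add: add_ac)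
    then have "h n * h n * fu (x + a n *\<^sub>R u + b n *\<^sub>R v) v = h n * h n * fv (x + a' n *\<^sub>R v + b' n *\<^sub>R u) u"
      using ab[of n] ab'[of n] by linarith
    then show ?thesis using hpos[of n] by simp
  qed
  ultimately show ?thesis using LIMSEQ_unique by auto
qed

lemma second_derivative_symmetric:
  fixes f :: "'a::euclidean_space \<Rightarrow> 'b::euclidean_space"
  assumes "smooth f"
  shows "frechet_derivative (\<lambda>y. frechet_derivative f (at y) u) (at x) v =
         frechet_derivative (\<lambda>y. frechet_derivative f (at y) v) (at x) u"
proof (rule euclidean_eqI)
  fix b :: 'b
  note d = bounded_linear.has_derivative[OF bounded_linear_inner_left[of b]]
  have sm: "smooth (\<lambda>y. frechet_derivative f (at y) w)" for w
    by (rule smooth_frechet_derivative[OF assms])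
  show "frechet_derivative (\<lambda>y. frechet_derivative f (at y) u) (at x) v \<bullet> b =
         frechet_derivative (\<lambda>y. frechet_derivative f (at y) v) (at x) u \<bullet> b"
    by (rule second_derivative_symmetric_real[where f = "\<lambda>x. f x \<bullet> b"
          and f' = "\<lambda>x w. frechet_derivative f (at x) w \<bullet> b"
          and fu = "\<lambda>x w. frechet_derivative (\<lambda>y. frechet_derivative f (at y) u) (at x) w \<bullet> b"
          and fv = "\<lambda>x w. frechet_derivative (\<lambda>y. frechet_derivative f (at y) v) (at x) w \<bullet> b"])
      (intro d smooth_has_derivative sm assms smooth_continuous[OF smooth_inner_left]
        smooth_frechet_derivative[OF sm])+
qed

section \<open>Connections and their Christoffel symbols\<close>

lemma linear_connectionD:
  fixes D :: "'a::euclidean_space connection"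
  assumes "linear_connection D"
  shows connection_smooth: "\<And>X Y. smooth X \<Longrightarrow> smooth Y \<Longrightarrow> smooth (D X Y)"
    and connection_add_left: "\<And>X X' Y. smooth X \<Longrightarrow> smooth X' \<Longrightarrow> smooth Y \<Longrightarrow>
        D (\<lambda>p. X p + X' p) Y = (\<lambda>p. D X Y p + D X' Y p)"
    and connection_add_right: "\<And>X Y Y'. smooth X \<Longrightarrow> smooth Y \<Longrightarrow> smooth Y' \<Longrightarrow>
        D X (\<lambda>p. Y p + Y' p) = (\<lambda>p. D X Y p + D X Y' p)"
    and connection_scale_left: "\<And>(f :: 'a \<Rightarrow> real) X Y. smooth f \<Longrightarrow> smooth X \<Longrightarrow> smooth Y \<Longrightarrow>
        D (\<lambda>p. f p *\<^sub>R X p) Y = (\<lambda>p. f p *\<^sub>R D X Y p)"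
    and connection_Leibniz: "\<And>(f :: 'a \<Rightarrow> real) X Y. smooth f \<Longrightarrow> smooth X \<Longrightarrow> smooth Y \<Longrightarrow>
        D X (\<lambda>p. f p *\<^sub>R Y p) =
          (\<lambda>p. frechet_derivative f (at p) (X p) *\<^sub>R Y p + f p *\<^sub>R D X Y p)"
  using assms unfolding linear_connection_def by blast+

lemma connection_sum_left:
  assumes D: "linear_connection D" and Y: "smooth Y" and X: "\<And>i. i \<in> I \<Longrightarrow> smooth (X i)"
  shows "D (\<lambda>p. \<Sum>i\<in>I. X i p) Y = (\<lambda>p. \<Sum>i\<in>I. D (X i) Y p)"
proof -
  have 0: "D (\<lambda>p. 0) Y = (\<lambda>p. 0)"
    using connection_scale_left[OF D smooth_const[of 0] Y Y] by simp
  show ?thesis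
    using X
    by (induction I rule: infinite_finite_induct)
      (simp_all add: 0 connection_add_left[OF D _ _ Y] smooth_sum)
qed

lemma connection_sum_right:
  assumes D: "linear_connection D" and X: "smooth X" and Y: "\<And>i. i \<in> I \<Longrightarrow> smooth (Y i)"
  shows "D X (\<lambda>p. \<Sum>i\<in>I. Y i p) = (\<lambda>p. \<Sum>i\<in>I. D X (Y i) p)"
proof -
  have 0: "D X (\<lambda>p. 0) = (\<lambda>p. 0)"
    using connection_Leibniz[OF D smooth_const[of 0] X X] by simp
  show ?thesis
    using Y
    by (induction I rule: infinite_finite_induct)
      (simp_all add: 0 connection_add_right[OF D X] smooth_sum)
qed

lemma bilinear_christoffel:
  assumes D: "linear_connection D"
  shows "bilinear (christoffel D p)"
proof -
  have "christoffel D p u (x + y) = christoffel D p u x + christoffel D p u y" for u x y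
    unfolding christoffel_def by (subst connection_add_right[OF D]) (auto simp: smooth_const)
  moreover have "christoffel D p u (r *\<^sub>R x) = r *\<^sub>R christoffel D p u x" for u x r
    unfolding christoffel_def
    using connection_Leibniz[OF D smooth_const[of r] smooth_const[of u] smooth_const[of x]] by simp
  moreover have "christoffel D p (x + y) u = christoffel D p x u + christoffel D p y u" for u x y
    unfolding christoffel_def by (subst connection_add_left[OF D]) (auto simp: smooth_const)
  moreover have "christoffel D p (r *\<^sub>R x) u = r *\<^sub>R christoffel D p x u" for u x r
    unfolding christoffel_def
    using connection_scale_left[OF D smooth_const[of r] smooth_const[of x] smooth_const[of u]] by simp
  ultimately show ?thesis unfolding bilinear_def by (auto intro!: linearI)
qed

lemma smooth_christoffel: "linear_connection D \<Longrightarrow> smooth (\<lambda>p. christoffel D p u v)"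
  unfolding christoffel_def by (simp add: connection_smooth smooth_const)

text \<open>The constant fields form a global frame. Linearity over functions pulls out the
  coefficients of X, and the Leibniz rule turns those of Y into the derivative of Y.\<close>

lemma connection_eq_christoffel:
  assumes D: "linear_connection D" and X: "smooth X" and Y: "smooth Y"
  shows "D X Y p = frechet_derivative Y (at p) (X p) + christoffel D p (X p) (Y p)"
proof -
  have dY: "frechet_derivative (\<lambda>q. Y q \<bullet> b) (at p) v = frechet_derivative Y (at p) v \<bullet> b" for b v
    by (simp add: frechet_derivative_eqI[OF bounded_linear.has_derivative[OF bounded_linear_inner_left
            smooth_has_derivative[OF Y]]])
  have const: "D (\<lambda>q. u) Y p = frechet_derivative Y (at p) u + christoffel D p u (Y p)" for u
  proof -
    have "D (\<lambda>q. u) Y p = D (\<lambda>q. u) (\<lambda>q. \<Sum>b\<in>Basis. (Y q \<bullet> b) *\<^sub>R b) p"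
      by (simp add: euclidean_representation)
    also have "\<dots> = (\<Sum>b\<in>Basis. (frechet_derivative Y (at p) u \<bullet> b) *\<^sub>R b + (Y p \<bullet> b) *\<^sub>R christoffel D p u b)"
      by (simp add: connection_sum_right[OF D smooth_const] smooth_scaleR smooth_inner_left Y smooth_const
          connection_Leibniz[OF D] dY christoffel_def)
    also have "\<dots> = frechet_derivative Y (at p) u + christoffel D p u (Y p)"
      using linear_Basis_expansion[of "christoffel D p u" "Y p"] bilinear_christoffel[OF D, of p]
      by (simp add: sum.distrib euclidean_representation bilinear_def)
    finally show ?thesis .
  qed
  have "D X Y p = D (\<lambda>q. \<Sum>b\<in>Basis. (X q \<bullet> b) *\<^sub>R b) Y p"
    by (simp add: euclidean_representation)
  also have "\<dots> = (\<Sum>b\<in>Basis. (X p \<bullet> b) *\<^sub>R (frechet_derivative Y (at p) b + christoffel D p b (Y p)))"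
    by (simp add: connection_sum_left[OF D Y] smooth_scaleR smooth_inner_left X smooth_const
        connection_scale_left[OF D _ _ Y] const)
  also have "\<dots> = frechet_derivative Y (at p) (X p) + christoffel D p (X p) (Y p)"
    using linear_Basis_expansion[of "\<lambda>u. frechet_derivative Y (at p) u + christoffel D p u (Y p)" "X p"]
      bilinear_christoffel[OF D, of p] smooth_linear_derivative[OF Y, of p]
    by (simp add: linear_compose_add bilinear_def)
  finally show ?thesis .
qed

text \<open>In finite dimension this product rule needs derivatives of F at fixed vectors only,
  since the expansion in \<open>Basis\<close> leaves finitely many scalar products.\<close>

lemma has_derivative_linear_family:
  fixes F :: "'a::real_normed_vector \<Rightarrow> 'b::euclidean_space \<Rightarrow> 'c::real_normed_vector"
  assumes lin: "\<And>q. linear (F q)"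
    and F: "\<And>v. ((\<lambda>q. F q v) has_derivative F' v) (at p)"
    and g: "(g has_derivative g') (at p)"
  shows "((\<lambda>q. F q (g q)) has_derivative (\<lambda>h. F' (g p) h + F p (g' h))) (at p)"
proof -
  have 1: "((\<lambda>q. F q v) has_derivative (\<lambda>h. \<Sum>b\<in>Basis. (v \<bullet> b) *\<^sub>R F' b h)) (at p)" for v
  proof -
    have eq: "(\<lambda>q. F q v) = (\<lambda>q. \<Sum>b\<in>Basis. (v \<bullet> b) *\<^sub>R F q b)"
      by (rule ext) (rule linear_Basis_expansion[OF lin])
    show ?thesis unfolding eq by (auto intro!: derivative_eq_intros F)
  qed
  \<comment> \<open>Linearity of \<open>F'\<close> in v is not assumed; it is inherited from F by
    uniqueness of the derivative.\<close>
  have F': "F' v h = (\<Sum>b\<in>Basis. (v \<bullet> b) *\<^sub>R F' b h)" for v h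
    using has_derivative_unique[OF F 1] by metis
  have eq: "(\<lambda>q. F q (g q)) = (\<lambda>q. \<Sum>b\<in>Basis. (g q \<bullet> b) *\<^sub>R F q b)"
    by (rule ext) (rule linear_Basis_expansion[OF lin])
  have "((\<lambda>q. F q (g q)) has_derivative
    (\<lambda>h. \<Sum>b\<in>Basis. (g p \<bullet> b) *\<^sub>R F' b h + (g' h \<bullet> b) *\<^sub>R F p b)) (at p)"
    unfolding eq by (auto intro!: derivative_eq_intros F g)
  then show ?thesis
    by (rule has_derivative_eq_rhs)
      (simp add: fun_eq_iff sum.distrib F'[of "g p"] linear_Basis_expansion[OF lin, of _ "g' _"])
qed

text \<open>The linear case is used twice: with the first argument frozen, and then for the
  resulting family in that argument.\<close>

lemma has_derivative_bilinear_family: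
  fixes F :: "'a::real_normed_vector \<Rightarrow> 'b::euclidean_space \<Rightarrow> 'd::euclidean_space \<Rightarrow> 'c::real_normed_vector"
  assumes bil: "\<And>q. bilinear (F q)"
    and F: "\<And>u v. ((\<lambda>q. F q u v) has_derivative F' u v) (at p)"
    and f: "(f has_derivative f') (at p)" and g: "(g has_derivative g') (at p)"
  shows "((\<lambda>q. F q (f q) (g q)) has_derivative
    (\<lambda>h. F' (f p) (g p) h + F p (f p) (g' h) + F p (f' h) (g p))) (at p)"
proof -
  have l1: "linear (F q u)" for q u using bil by (auto simp: bilinear_def)
  have l2: "linear (\<lambda>u. F q u v)" for q v using bil by (auto simp: bilinear_def)
  have "((\<lambda>q. F q u (g q)) has_derivative (\<lambda>h. F' u (g p) h + F p u (g' h))) (at p)" for u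
    by (rule has_derivative_linear_family[where F = "\<lambda>q. F q u", OF l1 F g])
  from has_derivative_linear_family[where F = "\<lambda>q u. F q u (g q)", OF l2 this f]
  show ?thesis .
qed

lemma has_derivative_derivative_apply:
  assumes "smooth f" "(g has_derivative g') (at p)"
  shows "((\<lambda>q. frechet_derivative f (at q) (g q)) has_derivative
    (\<lambda>h. frechet_derivative (\<lambda>q. frechet_derivative f (at q) (g p)) (at p) h
       + frechet_derivative f (at p) (g' h))) (at p)"
  by (rule has_derivative_linear_family[where F = "\<lambda>q. frechet_derivative f (at q)",
        OF smooth_linear_derivative[OF assms(1)] smooth_has_derivative[OF smooth_frechet_derivative[OF assms(1)]]
          assms(2)])

section \<open>Curvature, torsion and invariance through Christoffel symbols\<close>

lemma smooth_vf_bracket: "smooth X \<Longrightarrow> smooth Y \<Longrightarrow> smooth (vf_bracket X Y)"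
  unfolding vf_bracket_def by (intro smooth_diff smooth_derivative_apply smooth_ident)

lemma smooth_curvature:
  assumes "linear_connection D" "smooth X" "smooth Y" "smooth Z"
  shows "smooth (curvature D X Y Z)"
  unfolding curvature_def
  by (intro smooth_diff connection_smooth[OF assms(1)] smooth_vf_bracket assms)

text \<open>The second derivatives of Z cancel by symmetry, the terms pairing \<Gamma> with dZ
  cancel on exchanging X and Y, and those with dX and dY are absorbed by the bracket. Only the
  values of the fields at p survive.\<close>

lemma curvature_eq_christoffel:
  assumes D: "linear_connection D" and X: "smooth X" and Y: "smooth Y" and Z: "smooth Z"
  shows "curvature D X Y Z p =
    frechet_derivative (\<lambda>q. christoffel D q (Y p) (Z p)) (at p) (X p)
    - frechet_derivative (\<lambda>q. christoffel D q (X p) (Z p)) (at p) (Y p)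
    + christoffel D p (X p) (christoffel D p (Y p) (Z p))
    - christoffel D p (Y p) (christoffel D p (X p) (Z p))"
proof -
  note \<Gamma> = bilinear_christoffel[OF D, of p]
  have twice: "D X (D Y Z) p =
      frechet_derivative (\<lambda>q. frechet_derivative Z (at q) (Y p)) (at p) (X p)
      + frechet_derivative Z (at p) (frechet_derivative Y (at p) (X p))
      + frechet_derivative (\<lambda>q. christoffel D q (Y p) (Z p)) (at p) (X p)
      + christoffel D p (Y p) (frechet_derivative Z (at p) (X p))
      + christoffel D p (frechet_derivative Y (at p) (X p)) (Z p)
      + christoffel D p (X p) (frechet_derivative Z (at p) (Y p))
      + christoffel D p (X p) (christoffel D p (Y p) (Z p))"
    if X: "smooth X" and Y: "smooth Y" for X Y
  proof -
    have eq: "D Y Z = (\<lambda>q. frechet_derivative Z (at q) (Y q) + christoffel D q (Y q) (Z q))"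
      by (rule ext) (rule connection_eq_christoffel[OF D Y Z])
    have "(D Y Z has_derivative (\<lambda>h.
      (frechet_derivative (\<lambda>q. frechet_derivative Z (at q) (Y p)) (at p) h
        + frechet_derivative Z (at p) (frechet_derivative Y (at p) h))
      + (frechet_derivative (\<lambda>q. christoffel D q (Y p) (Z p)) (at p) h
        + christoffel D p (Y p) (frechet_derivative Z (at p) h)
        + christoffel D p (frechet_derivative Y (at p) h) (Z p)))) (at p)"
      unfolding eq
      by (intro has_derivative_add has_derivative_derivative_apply Z
          has_derivative_bilinear_family[where F = "christoffel D"]
          bilinear_christoffel[OF D] smooth_has_derivative[OF smooth_christoffel[OF D]]
          smooth_has_derivative[OF Y] smooth_has_derivative[OF Z])
    then show ?thesis
      unfolding connection_eq_christoffel[OF D X connection_smooth[OF D Y Z]]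
      by (simp add: frechet_derivative_eqI eq bilinear_radd[OF \<Gamma>])
  qed
  have bracket: "D (vf_bracket X Y) Z p =
      frechet_derivative Z (at p) (frechet_derivative Y (at p) (X p) - frechet_derivative X (at p) (Y p))
      + christoffel D p (frechet_derivative Y (at p) (X p) - frechet_derivative X (at p) (Y p)) (Z p)"
    unfolding connection_eq_christoffel[OF D smooth_vf_bracket[OF X Y] Z] by (simp add: vf_bracket_def)
  show ?thesis
    unfolding curvature_def twice[OF X Y] twice[OF Y X] bracket
    by (simp add: second_derivative_symmetric[OF Z, of "Y p"] bilinear_lsub[OF \<Gamma>]
        linear_diff[OF smooth_linear_derivative[OF Z]])
qed

lemma torsion_free_christoffel:
  assumes D: "linear_connection D" and sym: "\<And>p u v. christoffel D p u v = christoffel D p v u"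
  shows "torsion_free D"
  unfolding torsion_free_def torsion_def vf_bracket_def
  using sym by (simp add: connection_eq_christoffel[OF D])

text \<open>The last hypothesis is the transformation law of Christoffel symbols; its second
  derivative comes from differentiating the pushforward of Y.\<close>

lemma invariant_under_christoffel:
  fixes \<phi> :: "'a::euclidean_space \<Rightarrow> 'a"
  assumes D: "linear_connection D" and \<phi>: "smooth \<phi>" and \<psi>: "smooth \<psi>"
    and inv: "\<And>p. \<psi> (\<phi> p) = p" "\<And>q. \<phi> (\<psi> q) = q"
    and \<Gamma>: "\<And>p u v. frechet_derivative (\<lambda>q. frechet_derivative \<phi> (at q) v) (at p) u
      + christoffel D (\<phi> p) (frechet_derivative \<phi> (at p) u) (frechet_derivative \<phi> (at p) v)
      = frechet_derivative \<phi> (at p) (christoffel D p u v)"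
  shows "invariant_under \<phi> D"
  unfolding invariant_under_def
proof (intro allI impI ext)
  fix X Y :: "'a vfield" and q :: 'a
  assume X: "smooth X" and Y: "smooth Y"
  have "inv_into UNIV \<phi> = \<psi>"
    by (rule inv_equality) (simp_all add: inv)
  then have push: "pushforward \<phi> Z = (\<lambda>q. frechet_derivative \<phi> (at (\<psi> q)) (Z (\<psi> q)))" for Z
    by (simp add: pushforward_def)
  have smooth_push: "smooth (pushforward \<phi> Z)" if "smooth Z" for Z
    unfolding push by (intro smooth_derivative_apply \<phi> \<psi> smooth_compose[OF that])
  define p where "p = \<psi> q"
  have q: "\<phi> p = q" by (simp add: p_def inv)
  \<comment> \<open>Differentiating \<open>\<psi> (\<phi> x) = x\<close> shows that d\<psi> undoes
    d\<phi>, so the direction in which Y gets differentiated at p is again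
    \<open>X p\<close>.\<close>
  have "((\<lambda>x. \<psi> (\<phi> x)) has_derivative
    (\<lambda>h. frechet_derivative \<psi> (at q) (frechet_derivative \<phi> (at p) h))) (at p)"
    using has_derivative_compose[OF smooth_has_derivative[OF \<phi>, of p] smooth_has_derivative[OF \<psi>]]
    by (simp add: q)
  then have "(\<lambda>h. frechet_derivative \<psi> (at q) (frechet_derivative \<phi> (at p) h)) = (\<lambda>h. h)"
    unfolding inv by (rule has_derivative_unique[OF _ has_derivative_ident])
  then have d\<psi>: "frechet_derivative \<psi> (at q) (frechet_derivative \<phi> (at p) h) = h" for h
    by (rule fun_cong)
  have "(pushforward \<phi> Y has_derivative (\<lambda>h.
      frechet_derivative (\<lambda>q. frechet_derivative \<phi> (at q) (Y p)) (at p) (frechet_derivative \<psi> (at q) h)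
      + frechet_derivative \<phi> (at p) (frechet_derivative Y (at p) (frechet_derivative \<psi> (at q) h)))) (at q)"
    unfolding push
    using has_derivative_compose[OF smooth_has_derivative[OF \<psi>, of q, folded p_def]
        has_derivative_derivative_apply[OF \<phi> smooth_has_derivative[OF Y], of "\<psi> q"]]
    by (simp add: p_def)
  then have "D (pushforward \<phi> X) (pushforward \<phi> Y) q =
      frechet_derivative (\<lambda>q. frechet_derivative \<phi> (at q) (Y p)) (at p) (X p)
      + frechet_derivative \<phi> (at p) (frechet_derivative Y (at p) (X p))
      + christoffel D q (frechet_derivative \<phi> (at p) (X p)) (frechet_derivative \<phi> (at p) (Y p))"
    unfolding connection_eq_christoffel[OF D smooth_push[OF X] smooth_push[OF Y]]
    by (simp add: frechet_derivative_eqI d\<psi>) (simp add: d\<psi> push p_def[symmetric])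
  also have "\<dots> = pushforward \<phi> (D X Y) q"
    using \<Gamma>[where p = p and u = "X p" and v = "Y p"]
    by (simp add: q push p_def[symmetric] connection_eq_christoffel[OF D X Y]
        linear_add[OF smooth_linear_derivative[OF \<phi>]])
  finally show "pushforward \<phi> (D X Y) q = D (pushforward \<phi> X) (pushforward \<phi> Y) q" by simp
qed

section \<open>The oscillator group\<close>

text \<open>The group law of \<open>osc_group lam\<close> is that of the Heisenberg group of the symplectic form
  \<open>osc_form\<close>, twisted by the one-parameter group \<open>osc_rot lam\<close> of symplectic maps with
  generator \<open>osc_gen lam\<close>.\<close>

definition osc_form :: "complex ^ 'n::finite \<Rightarrow> complex ^ 'n \<Rightarrow> real" where
  "osc_form z w = (\<Sum>j\<in>UNIV. Im (cnj (z $ j) * w $ j))"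

definition osc_gen :: "real ^ 'n::finite \<Rightarrow> complex ^ 'n \<Rightarrow> complex ^ 'n" where
  "osc_gen lam z = (\<chi> j. \<i> * complex_of_real (lam $ j) * z $ j)"

definition osc_rot :: "real ^ 'n::finite \<Rightarrow> real \<Rightarrow> complex ^ 'n \<Rightarrow> complex ^ 'n" where
  "osc_rot lam t z = (\<chi> j. exp (\<i> * complex_of_real (t * lam $ j)) * z $ j)"

lemma bilinear_osc_form: "bilinear osc_form"
  unfolding bilinear_def osc_form_def
  by (auto intro!: linearI simp: algebra_simps sum.distrib sum_distrib_left sum_subtractf)

lemmas bounded_bilinear_osc_form = bilinear_osc_form[unfolded bilinear_conv_bounded_bilinear]

lemmas osc_form_simps =
  bounded_bilinear.add_left[OF bounded_bilinear_osc_form]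
  bounded_bilinear.add_right[OF bounded_bilinear_osc_form]
  bounded_bilinear.diff_left[OF bounded_bilinear_osc_form]
  bounded_bilinear.diff_right[OF bounded_bilinear_osc_form]
  bounded_bilinear.minus_left[OF bounded_bilinear_osc_form]
  bounded_bilinear.minus_right[OF bounded_bilinear_osc_form]
  bounded_bilinear.zero_left[OF bounded_bilinear_osc_form]
  bounded_bilinear.zero_right[OF bounded_bilinear_osc_form]
  bounded_bilinear.scaleR_left[OF bounded_bilinear_osc_form]
  bounded_bilinear.scaleR_right[OF bounded_bilinear_osc_form]

lemma osc_form_skew: "osc_form w z = - osc_form z w"
  unfolding osc_form_def by (simp add: sum_negf[symmetric] algebra_simps)

lemma linear_osc_gen: "linear (osc_gen lam)"
  by (auto intro!: linearI simp: osc_gen_def vec_eq_iff algebra_simps scaleR_conv_of_real)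

lemmas bounded_linear_osc_gen = linear_osc_gen[unfolded linear_conv_bounded_linear]

lemmas osc_gen_simps =
  linear_add[OF linear_osc_gen] linear_diff[OF linear_osc_gen] linear_scale[OF linear_osc_gen]
  linear_neg[OF linear_osc_gen] linear_0[OF linear_osc_gen]

text \<open>Conjugation changes the sign of the imaginary unit and fixes the real
  \<open>lam $ j\<close>: J lies in the Lie algebra of the symplectic group.\<close>

lemma osc_form_gen: "osc_form (osc_gen lam z) w = - osc_form z (osc_gen lam w)"
  unfolding osc_form_def osc_gen_def by (simp add: sum_negf[symmetric] algebra_simps)

lemma osc_form_gen_commute: "osc_form z (osc_gen lam w) = osc_form w (osc_gen lam z)"
  by (metis osc_form_gen osc_form_skew)

text \<open>As J is skew for \<omega>, the form \<omega>(_, J _) is symmetric and \<omega>(_, J J _)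
  is skew again. These two rules bring terms to a common order of arguments.\<close>

lemma osc_form_gen_gen:
  "osc_form z (osc_gen lam (osc_gen lam w)) = - osc_form w (osc_gen lam (osc_gen lam z))"
  using osc_form_gen[of lam w "osc_gen lam z"] osc_form_gen_commute[of z lam "osc_gen lam w"] by simp

lemma linear_osc_rot: "linear (osc_rot lam t)"
  by (auto intro!: linearI simp: osc_rot_def vec_eq_iff algebra_simps scaleR_conv_of_real)

lemmas osc_rot_simps =
  linear_add[OF linear_osc_rot] linear_diff[OF linear_osc_rot] linear_scale[OF linear_osc_rot]
  linear_neg[OF linear_osc_rot] linear_0[OF linear_osc_rot]

lemma osc_rot_zero [simp]: "osc_rot lam 0 z = z"
  by (simp add: osc_rot_def vec_eq_iff)

lemma osc_rot_add: "osc_rot lam (s + t) z = osc_rot lam s (osc_rot lam t z)"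
  by (simp add: osc_rot_def vec_eq_iff ring_distribs exp_add)

lemma osc_rot_inverse [simp]:
  "osc_rot lam t (osc_rot lam (- t) z) = z" "osc_rot lam (- t) (osc_rot lam t z) = z"
  by (simp_all add: osc_rot_add[symmetric])

lemma osc_rot_gen: "osc_rot lam t (osc_gen lam z) = osc_gen lam (osc_rot lam t z)"
  by (simp add: osc_rot_def osc_gen_def vec_eq_iff)

text \<open>The phases have modulus 1 and cancel in every summand.\<close>

lemma osc_form_rot: "osc_form (osc_rot lam t z) (osc_rot lam t w) = osc_form z w"
proof -
  have "cnj (exp (\<i> * complex_of_real r)) * exp (\<i> * complex_of_real r) = 1" for r
    by (simp add: exp_cnj exp_add[symmetric])
  then have e: "cnj (exp (\<i> * complex_of_real r) * x) * (exp (\<i> * complex_of_real r) * y) = cnj x * y" for r x y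
    by (simp add: algebra_simps)
  show ?thesis unfolding osc_form_def osc_rot_def by (simp only: e vec_lambda_beta)
qed

lemma has_derivative_osc_rot_time:
  "((\<lambda>t. osc_rot lam t z) has_derivative (\<lambda>h. h *\<^sub>R osc_gen lam (osc_rot lam t z))) (at t within S)"
proof (rule has_derivative_componentwise_within[THEN iffD2], rule ballI)
  fix b :: "complex ^ 'a" assume "b \<in> Basis"
  have 1: "((\<lambda>t. exp (\<i> * complex_of_real (t * l)) * x) has_derivative
      (\<lambda>h. h *\<^sub>R (\<i> * complex_of_real l * (exp (\<i> * complex_of_real (t * l)) * x)))) (at t within S)" for l x
  proof -
    have "((\<lambda>t. \<i> * complex_of_real (t * l)) has_derivative (\<lambda>h. \<i> * complex_of_real (h * l))) (at t within S)"
      by (auto intro!: derivative_eq_intros)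
    from has_derivative_mult_left[OF has_derivative_compose[OF this
          DERIV_exp[unfolded has_field_derivative_def]], of x]
    show ?thesis by (rule has_derivative_eq_rhs) (auto simp: scaleR_conv_of_real algebra_simps)
  qed
  show "((\<lambda>t. osc_rot lam t z \<bullet> b) has_derivative
      (\<lambda>h. h *\<^sub>R osc_gen lam (osc_rot lam t z) \<bullet> b)) (at t within S)"
    unfolding osc_rot_def osc_gen_def inner_vec_def
    by (simp only: vec_lambda_beta vector_scaleR_component)
      (intro has_derivative_sum bounded_linear.has_derivative[OF bounded_linear_inner_left] 1)
qed

lemma has_derivative_osc_rot:
  assumes "(f has_derivative f') (at p)" "(g has_derivative g') (at p)"
  shows "((\<lambda>q. osc_rot lam (f q) (g q)) has_derivative
    (\<lambda>h. f' h *\<^sub>R osc_gen lam (osc_rot lam (f p) (g p)) + osc_rot lam (f p) (g' h))) (at p)"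
  by (rule has_derivative_linear_family[OF linear_osc_rot
        has_derivative_compose[OF assms(1) has_derivative_osc_rot_time] assms(2)])

lemma smooth_osc_rot:
  assumes f: "smooth f" and g: "smooth g"
  shows "smooth (\<lambda>p. osc_rot lam (f p) (g p))"
proof -
  have "C_k k (\<lambda>t. osc_rot lam t z)" for k z
  proof (induction k arbitrary: z)
    case 0
    have "(\<lambda>t. osc_rot lam t z) differentiable (at t)" for t
      by (rule differentiableI[OF has_derivative_osc_rot_time])
    then show ?case
      by (simp add: continuous_at_imp_continuous_on differentiable_imp_continuous_within)
  next
    case (Suc k)
    have "C_k k (\<lambda>t. v *\<^sub>R osc_gen lam (osc_rot lam t z))" for v
      \<comment> \<open>The velocity of a rotated vector is the rotation of
        \<open>osc_gen lam z\<close>, a curve of the same kind with another z; hence the induction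
        over arbitrary z.\<close>
      using Suc.IH[of "v *\<^sub>R osc_gen lam z"] by (simp add: osc_rot_simps osc_rot_gen)
    then show ?case by (intro C_k_SucI[OF has_derivative_osc_rot_time])
  qed
  then have "smooth (\<lambda>t. osc_rot lam t z)" for z by (simp add: smooth_def)
  then show ?thesis
    by (subst linear_Basis_expansion[OF linear_osc_rot])
      (intro smooth_sum smooth_scaleR smooth_inner_left g smooth_compose[OF _ f])
qed

lemma smooth_Pair:
  fixes f :: "'a::euclidean_space \<Rightarrow> 'b::euclidean_space" and g :: "'a \<Rightarrow> 'c::euclidean_space"
  assumes "smooth f" "smooth g"
  shows "smooth (\<lambda>x. (f x, g x))"
proof -
  have "smooth (\<lambda>x. (f x, 0::'c) + (0::'b, g x))"
    by (intro smooth_add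
        smooth_compose_bounded_linear[OF bounded_linear_Pair[OF bounded_linear_ident bounded_linear_zero]]
        smooth_compose_bounded_linear[OF bounded_linear_Pair[OF bounded_linear_zero bounded_linear_ident]] assms)
  then show ?thesis by simp
qed

lemmas smooth_fst = smooth_compose_bounded_linear[OF bounded_linear_fst]
lemmas smooth_snd = smooth_compose_bounded_linear[OF bounded_linear_snd]
lemmas smooth_osc_form = smooth_bounded_bilinear[OF bounded_bilinear_osc_form]
lemmas smooth_mult = smooth_bounded_bilinear[OF bounded_bilinear_mult]

section \<open>The group law and its derivative\<close>

lemma osc_mult_eq:
  "osc_mult lam p q = (fst p + fst q,
     fst (snd p) + fst (snd q) + 1/2 * osc_form (snd (snd p)) (osc_rot lam (fst p) (snd (snd q))),
     snd (snd p) + osc_rot lam (fst p) (snd (snd q)))"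
  by (auto simp: osc_mult_def osc_form_def osc_rot_def split_beta vec_eq_iff mult.assoc)

text \<open>The term \<omega>/2 is a cocycle for the twisted law because rotations preserve
  \<omega>.\<close>

lemma osc_mult_assoc: "osc_mult lam (osc_mult lam p q) r = osc_mult lam p (osc_mult lam q r)"
  by (simp add: osc_mult_eq osc_rot_add osc_rot_simps osc_form_simps osc_form_rot algebra_simps)

text \<open>The central coordinate needs no correction: once the rotations are combined, the form is
  evaluated on proportional vectors and vanishes.\<close>

definition osc_inverse :: "real ^ 'n::finite \<Rightarrow> 'n osc \<Rightarrow> 'n osc" where
  "osc_inverse lam p = (- fst p, - fst (snd p), - osc_rot lam (- fst p) (snd (snd p)))"

lemma osc_form_self [simp]: "osc_form z z = 0"
  using osc_form_skew[of z z] by simp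

lemma osc_mult_inverse:
  "osc_mult lam (osc_inverse lam p) p = 0" "osc_mult lam p (osc_inverse lam p) = 0"
  by (simp_all add: osc_mult_eq osc_inverse_def osc_rot_simps osc_form_simps zero_prod_def)

lemma osc_mult_zero: "osc_mult lam 0 p = p" "osc_mult lam p 0 = p"
  by (simp_all add: osc_mult_eq osc_rot_simps osc_form_simps)

lemma smooth_osc_mult:
  assumes "smooth f" "smooth g"
  shows "smooth (\<lambda>p. osc_mult lam (f p) (g p))"
  unfolding osc_mult_eq
  by (intro smooth_Pair smooth_add smooth_fst smooth_snd smooth_osc_form smooth_osc_rot smooth_mult
      smooth_const assms)

text \<open>Both factors vary, so that left translations, right translations and left invariant
  fields are all special cases.\<close>

lemma has_derivative_osc_mult:
  assumes "(f has_derivative f') (at p)" "(g has_derivative g') (at p)"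
  shows "((\<lambda>q. osc_mult lam (f q) (g q)) has_derivative (\<lambda>h.
    (fst (f' h) + fst (g' h),
     fst (snd (f' h)) + fst (snd (g' h))
       + 1/2 * (osc_form (snd (snd (f p))) (fst (f' h) *\<^sub>R osc_gen lam (osc_rot lam (fst (f p)) (snd (snd (g p))))
                  + osc_rot lam (fst (f p)) (snd (snd (g' h))))
                + osc_form (snd (snd (f' h))) (osc_rot lam (fst (f p)) (snd (snd (g p))))),
     snd (snd (f' h)) + (fst (f' h) *\<^sub>R osc_gen lam (osc_rot lam (fst (f p)) (snd (snd (g p))))
                  + osc_rot lam (fst (f p)) (snd (snd (g' h))))))) (at p)"
  unfolding osc_mult_eq
  by (intro has_derivative_Pair has_derivative_add has_derivative_mult_right has_derivative_fst
      has_derivative_snd has_derivative_osc_rot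
      bounded_bilinear.FDERIV[OF bounded_bilinear_osc_form] assms)

section \<open>The connections on the oscillator group\<close>

lemma left_inv_field_osc:
  "left_inv_field (osc_group lam) u =
    (\<lambda>p. (fst u, fst (snd u) + 1/2 * osc_form (snd (snd p)) (osc_rot lam (fst p) (snd (snd u))),
      osc_rot lam (fst p) (snd (snd u))))"
proof
  fix p
  show "left_inv_field (osc_group lam) u p =
    (fst u, fst (snd u) + 1/2 * osc_form (snd (snd p)) (osc_rot lam (fst p) (snd (snd u))),
      osc_rot lam (fst p) (snd (snd u)))"
    unfolding left_inv_field_def osc_group_def
    using frechet_derivative_eqI[OF has_derivative_osc_mult[OF has_derivative_const[of p] has_derivative_ident, where p = "(0, 0, 0)" and lam = lam]]
    by (simp add: osc_form_simps osc_rot_simps)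
qed

lemma smooth_left_inv_field_osc: "smooth (left_inv_field (osc_group lam) u)"
  unfolding left_inv_field_osc
  by (intro smooth_Pair smooth_add smooth_fst smooth_snd smooth_osc_form smooth_osc_rot smooth_mult
      smooth_const smooth_ident)

lemma frechet_derivative_left_inv_field_osc:
  "frechet_derivative (left_inv_field (osc_group lam) u) (at p) h =
    (0, 1/2 * (fst h * osc_form (snd (snd p)) (osc_gen lam (osc_rot lam (fst p) (snd (snd u))))
          + osc_form (snd (snd h)) (osc_rot lam (fst p) (snd (snd u)))),
     fst h *\<^sub>R osc_gen lam (osc_rot lam (fst p) (snd (snd u))))"
proof -
  have "(left_inv_field (osc_group lam) u has_derivative (\<lambda>h.
    (0, 0 + 1/2 * (osc_form (snd (snd p)) (fst h *\<^sub>R osc_gen lam (osc_rot lam (fst p) (snd (snd u)))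
              + osc_rot lam (fst p) 0)
          + osc_form (snd (snd h)) (osc_rot lam (fst p) (snd (snd u)))),
     fst h *\<^sub>R osc_gen lam (osc_rot lam (fst p) (snd (snd u))) + osc_rot lam (fst p) 0))) (at p)"
    unfolding left_inv_field_osc
    by (intro has_derivative_Pair has_derivative_add has_derivative_mult_right has_derivative_fst
        has_derivative_snd has_derivative_osc_rot has_derivative_const has_derivative_ident
        bounded_bilinear.FDERIV[OF bounded_bilinear_osc_form])
  then show ?thesis by (simp add: frechet_derivative_eqI osc_rot_simps osc_form_simps)
qed

section \<open>Christoffel symbols of the two connections\<close>

definition osc_christoffel :: "real ^ 'n::finite \<Rightarrow> real \<Rightarrow> 'n osc \<Rightarrow> 'n osc \<Rightarrow> 'n osc \<Rightarrow> 'n osc" where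
  "osc_christoffel lam c p u v =
    (let w = osc_gen lam (fst u *\<^sub>R snd (snd v) + fst v *\<^sub>R snd (snd u))
     in (0, c * fst u * fst v - 1/4 * osc_form (snd (snd p)) w, - (1/2) *\<^sub>R w))"

text \<open>Both connections satisfy this predicate, with parameters c and 0, and their geometry is
  derived from it alone.\<close>

definition osc_connection :: "real ^ 'n::finite \<Rightarrow> real \<Rightarrow> 'n osc connection \<Rightarrow> bool" where
  "osc_connection lam c D \<longleftrightarrow> linear_connection D \<and> christoffel D = osc_christoffel lam c"

lemma osc_connectionI:
  fixes D :: "'n::finite osc connection"
  assumes D: "linear_connection D"
    and frame: "\<And>u v. D (left_inv_field (osc_group lam) u) (left_inv_field (osc_group lam) v) =
      (\<lambda>p. (1/2) *\<^sub>R vf_bracket (left_inv_field (osc_group lam) u) (left_inv_field (osc_group lam) v) p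
          + (0, c * fst u * fst v, 0))"
  shows "osc_connection lam c D"
  unfolding osc_connection_def
proof (intro conjI D ext)
  fix p u v :: "'n osc"
  let ?L = "left_inv_field (osc_group lam)"
  \<comment> \<open>\<open>f u\<close> is the Lie algebra element whose left invariant field takes
    the value u at p: the rotation is undone and the form term subtracted.\<close>
  define f where "f u = (fst u, fst (snd u) - 1/2 * osc_form (snd (snd p)) (snd (snd u)),
    osc_rot lam (- fst p) (snd (snd u)))" for u :: "'n osc"
  have L: "?L (f u) p = u" for u
    by (simp add: f_def left_inv_field_osc)
  let ?A = "frechet_derivative (?L (f v)) (at p) u" and ?B = "frechet_derivative (?L (f u)) (at p) v"
  have "D (?L (f u)) (?L (f v)) p = ?A + christoffel D p u v"
    by (simp add: connection_eq_christoffel[OF D smooth_left_inv_field_osc smooth_left_inv_field_osc] L)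
  moreover have "D (?L (f u)) (?L (f v)) p = (1/2) *\<^sub>R (?A - ?B) + (0, c * fst u * fst v, 0)"
    unfolding frame vf_bracket_def L by (simp add: f_def)
  ultimately have "christoffel D p u v = (1/2) *\<^sub>R (?A - ?B) + (0, c * fst u * fst v, 0) - ?A"
    by (simp add: algebra_simps)
  also have "\<dots> = (0, c * fst u * fst v, 0) - (1/2) *\<^sub>R (?A + ?B)"
    by (rule euclidean_eqI) (simp only: inner_simps, simp add: field_simps)
  finally have "christoffel D p u v = (0, c * fst u * fst v, 0) - (1/2) *\<^sub>R (?A + ?B)" .
  then show "christoffel D p u v = osc_christoffel lam c p u v"
    by (simp add: frechet_derivative_left_inv_field_osc prod_eq_iff osc_christoffel_def Let_def osc_gen_simps osc_form_simps f_def
        osc_form_skew[of "snd (snd u)" "snd (snd v)"] algebra_simps add_divide_distrib)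
qed

section \<open>Curvature and its covariant derivative\<close>

lemma frechet_derivative_osc_christoffel:
  "frechet_derivative (\<lambda>q. osc_christoffel lam c q u v) (at p) h =
    (0, - 1/4 * osc_form (snd (snd h)) (osc_gen lam (fst u *\<^sub>R snd (snd v) + fst v *\<^sub>R snd (snd u))), 0)"
proof -
  have "((\<lambda>q. osc_christoffel lam c q u v) has_derivative (\<lambda>h.
    (0, - 1/4 * osc_form (snd (snd h)) (osc_gen lam (fst u *\<^sub>R snd (snd v) + fst v *\<^sub>R snd (snd u))), 0))) (at p)"
    unfolding osc_christoffel_def Let_def
    by (auto intro!: has_derivative_Pair derivative_eq_intros bounded_bilinear.FDERIV[OF bounded_bilinear_osc_form]
      simp: osc_form_simps)
  then show ?thesis by (simp add: frechet_derivative_eqI)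
qed

text \<open>In the left invariant frame this is \<open>-1/4 [[u, v], w]\<close>; the parameter of
  \<open>osc_christoffel\<close> has dropped out.\<close>

definition osc_curvature :: "real ^ 'n::finite \<Rightarrow> 'n osc \<Rightarrow> 'n osc \<Rightarrow> 'n osc \<Rightarrow> 'n osc \<Rightarrow> 'n osc" where
  "osc_curvature lam p u v w =
    (let a = fst u *\<^sub>R snd (snd v) - fst v *\<^sub>R snd (snd u)
     in (0, 1/4 * osc_form a (osc_gen lam (snd (snd w)))
          + 1/8 * fst w * osc_form (snd (snd p)) (osc_gen lam (osc_gen lam a)),
         (1/4 * fst w) *\<^sub>R osc_gen lam (osc_gen lam a)))"

text \<open>Additivity lets a covariant derivative in any slot split into its derivative part and
  its Christoffel part.\<close>

lemma osc_curvature_linear: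
  "osc_curvature lam p (u + u') v w = osc_curvature lam p u v w + osc_curvature lam p u' v w"
  "osc_curvature lam p u (v + v') w = osc_curvature lam p u v w + osc_curvature lam p u v' w"
  "osc_curvature lam p u v (w + w') = osc_curvature lam p u v w + osc_curvature lam p u v w'"
  by (simp_all add: osc_curvature_def Let_def prod_eq_iff osc_gen_simps osc_form_simps algebra_simps
      add_divide_distrib diff_divide_distrib)

lemma curvature_osc:
  assumes D: "osc_connection lam c D" and X: "smooth X" and Y: "smooth Y" and Z: "smooth Z"
  shows "curvature D X Y Z p = osc_curvature lam p (X p) (Y p) (Z p)"
proof -
  have lin: "linear_connection D" and \<Gamma>: "christoffel D = osc_christoffel lam c"
    using D by (auto simp: osc_connection_def)
  show ?thesis
    unfolding curvature_eq_christoffel[OF lin X Y Z] \<Gamma> frechet_derivative_osc_christoffel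
    by (simp add: osc_christoffel_def osc_curvature_def Let_def prod_eq_iff osc_gen_simps osc_form_simps
        osc_form_gen_commute[of "snd (snd (Y p))"] algebra_simps add_divide_distrib diff_divide_distrib)
qed

text \<open>The first summand is the derivative of the curvature in the base point along x.
  Christoffel values have no time component, so acting by \<Gamma>(x, _) on u and v turns a = t(u)
  z(v) - t(v) z(u) into - 1/2 t(x) J a in total. The central terms with z(w) then cancel because J
  is skew, and the one with z(x) matches the first summand because \<omega>(_, J J _) is
  skew.\<close>

lemma osc_curvature_parallel:
  "(0, 1/8 * fst w * osc_form (snd (snd x))
        (osc_gen lam (osc_gen lam (fst u *\<^sub>R snd (snd v) - fst v *\<^sub>R snd (snd u)))), 0)
     + osc_christoffel lam c p x (osc_curvature lam p u v w)
   = osc_curvature lam p (osc_christoffel lam c p x u) v w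
     + osc_curvature lam p u (osc_christoffel lam c p x v) w
     + osc_curvature lam p u v (osc_christoffel lam c p x w)"
  by (auto simp: osc_christoffel_def osc_curvature_def Let_def prod_eq_iff osc_gen_simps osc_form_simps
      osc_form_gen osc_form_gen_gen[of "snd (snd x)"] algebra_simps
      add_divide_distrib diff_divide_distrib)

lemma has_derivative_osc_curvature:
  assumes X: "(X has_derivative X') (at p)" and Y: "(Y has_derivative Y') (at p)"
    and Z: "(Z has_derivative Z') (at p)"
  shows "((\<lambda>q. osc_curvature lam q (X q) (Y q) (Z q)) has_derivative
    (\<lambda>h. osc_curvature lam p (X' h) (Y p) (Z p) + osc_curvature lam p (X p) (Y' h) (Z p)
      + osc_curvature lam p (X p) (Y p) (Z' h)
      + (0, 1/8 * fst (Z p) * osc_form (snd (snd h))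
        (osc_gen lam (osc_gen lam (fst (X p) *\<^sub>R snd (snd (Y p)) - fst (Y p) *\<^sub>R snd (snd (X p))))), 0))) (at p)"
  unfolding osc_curvature_def Let_def
  by (rule has_derivative_eq_rhs, (rule has_derivative_Pair derivative_intros X Y Z
        bounded_bilinear.FDERIV[OF bounded_bilinear_osc_form]
        bounded_linear.has_derivative[OF bounded_linear_osc_gen])+)
    (simp add: fun_eq_iff prod_eq_iff osc_gen_simps osc_form_simps algebra_simps
      add_divide_distrib diff_divide_distrib)

lemma parallel_curvature_osc:
  assumes D: "osc_connection lam c D"
  shows "parallel_curvature D"
  unfolding parallel_curvature_def
proof (intro allI impI)
  fix W X Y Z :: "'a osc vfield" and p
  assume W: "smooth W" and X: "smooth X" and Y: "smooth Y" and Z: "smooth Z"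
  have lin: "linear_connection D" and \<Gamma>: "christoffel D = osc_christoffel lam c"
    using D by (auto simp: osc_connection_def)
  have R: "curvature D X Y Z = (\<lambda>q. osc_curvature lam q (X q) (Y q) (Z q))"
    by (rule ext) (rule curvature_osc[OF D X Y Z])
  note DW = connection_eq_christoffel[OF lin W, unfolded \<Gamma>] connection_smooth[OF lin W]
  have dR: "frechet_derivative (curvature D X Y Z) (at p) (W p) =
      osc_curvature lam p (frechet_derivative X (at p) (W p)) (Y p) (Z p)
      + osc_curvature lam p (X p) (frechet_derivative Y (at p) (W p)) (Z p)
      + osc_curvature lam p (X p) (Y p) (frechet_derivative Z (at p) (W p))
      + (0, 1/8 * fst (Z p) * osc_form (snd (snd (W p)))
        (osc_gen lam (osc_gen lam (fst (X p) *\<^sub>R snd (snd (Y p)) - fst (Y p) *\<^sub>R snd (snd (X p))))), 0)"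
    unfolding R by (simp add: frechet_derivative_eqI[OF has_derivative_osc_curvature[OF
            smooth_has_derivative[OF X] smooth_has_derivative[OF Y] smooth_has_derivative[OF Z]]])
  show "D W (curvature D X Y Z) p - curvature D (D W X) Y Z p
      - curvature D X (D W Y) Z p - curvature D X Y (D W Z) p = 0"
    unfolding DW(1)[OF smooth_curvature[OF lin X Y Z]] dR curvature_osc[OF D DW(2)[OF X] Y Z]
      curvature_osc[OF D X DW(2)[OF Y] Z] curvature_osc[OF D X Y DW(2)[OF Z]]
      curvature_osc[OF D X Y Z] DW(1)[OF X] DW(1)[OF Y] DW(1)[OF Z] osc_curvature_linear
    using osc_curvature_parallel[where w = "Z p" and x = "W p" and u = "X p" and v = "Y p" and p = p and lam = lam and c = c]
    by (simp only: algebra_simps) (simp add: algebra_simps)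
qed

lemma torsion_free_osc: "osc_connection lam c D \<Longrightarrow> torsion_free D"
  by (rule torsion_free_christoffel) (auto simp: osc_connection_def osc_christoffel_def Let_def algebra_simps)

section \<open>Translations and bi-invariance\<close>

text \<open>Left translations are affine in the chart: the differential does not depend on p, so the
  second derivative drops out of the transformation law.\<close>

lemma frechet_derivative_osc_mult_left:
  "frechet_derivative (\<lambda>g. osc_mult lam a g) (at p) u =
    (fst u, fst (snd u) + 1/2 * osc_form (snd (snd a)) (osc_rot lam (fst a) (snd (snd u))),
     osc_rot lam (fst a) (snd (snd u)))"
  using frechet_derivative_eqI[OF has_derivative_osc_mult[OF has_derivative_const[of a] has_derivative_ident,
      where p = p and lam = lam]]
  by (simp add: osc_form_simps)

lemma frechet_derivative_osc_mult_right:
  "frechet_derivative (\<lambda>g. osc_mult lam g a) (at p) u =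
    (fst u, fst (snd u) + 1/2 * (fst u * osc_form (snd (snd p)) (osc_gen lam (osc_rot lam (fst p) (snd (snd a))))
       + osc_form (snd (snd u)) (osc_rot lam (fst p) (snd (snd a)))),
     snd (snd u) + fst u *\<^sub>R osc_gen lam (osc_rot lam (fst p) (snd (snd a))))"
  using frechet_derivative_eqI[OF has_derivative_osc_mult[OF has_derivative_ident has_derivative_const[of a],
      where p = p and lam = lam]]
  by (simp add: osc_form_simps osc_rot_simps)

text \<open>A right translation rotates the fixed factor by an angle that depends on the moving
  point, so it is not affine. This is the inhomogeneous term of its transformation law.\<close>

lemma second_derivative_osc_mult_right:
  "frechet_derivative (\<lambda>q. frechet_derivative (\<lambda>g. osc_mult lam g a) (at q) v) (at p) u =
    (let r = osc_rot lam (fst p) (snd (snd a))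
     in (0, 1/2 * (fst v * (fst u * osc_form (snd (snd p)) (osc_gen lam (osc_gen lam r))
               + osc_form (snd (snd u)) (osc_gen lam r))
            + fst u * osc_form (snd (snd v)) (osc_gen lam r)),
         (fst u * fst v) *\<^sub>R osc_gen lam (osc_gen lam r)))"
proof -
  have r: "((\<lambda>q. osc_rot lam (fst q) (snd (snd a))) has_derivative
      (\<lambda>h. fst h *\<^sub>R osc_gen lam (osc_rot lam (fst p) (snd (snd a))))) (at p)"
    using has_derivative_osc_rot[OF has_derivative_fst[OF has_derivative_ident] has_derivative_const]
    by (simp add: osc_rot_simps)
  have "((\<lambda>q. frechet_derivative (\<lambda>g. osc_mult lam g a) (at q) v) has_derivative
    (\<lambda>u. let r = osc_rot lam (fst p) (snd (snd a))
     in (0, 1/2 * (fst v * (fst u * osc_form (snd (snd p)) (osc_gen lam (osc_gen lam r))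
               + osc_form (snd (snd u)) (osc_gen lam r))
            + fst u * osc_form (snd (snd v)) (osc_gen lam r)),
         (fst u * fst v) *\<^sub>R osc_gen lam (osc_gen lam r)))) (at p)"
    unfolding frechet_derivative_osc_mult_right
    by (rule has_derivative_eq_rhs, (rule has_derivative_Pair derivative_intros r
        bounded_bilinear.FDERIV[OF bounded_bilinear_osc_form]
        bounded_linear.has_derivative[OF bounded_linear_osc_gen])+)
      (simp add: fun_eq_iff Let_def osc_gen_simps osc_form_simps algebra_simps add_divide_distrib)
  then show ?thesis by (simp only: frechet_derivative_eqI)
qed

lemma bi_invariant_osc:
  assumes D: "osc_connection lam c D"
  shows "bi_invariant (osc_group lam) D"
proof -
  have lin: "linear_connection D" and \<Gamma>: "christoffel D = osc_christoffel lam c"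
    using D by (auto simp: osc_connection_def)
  have inv: "osc_mult lam (osc_inverse lam a) (osc_mult lam a p) = p"
    "osc_mult lam a (osc_mult lam (osc_inverse lam a) p) = p"
    "osc_mult lam (osc_mult lam p a) (osc_inverse lam a) = p"
    "osc_mult lam (osc_mult lam p (osc_inverse lam a)) a = p" for a p
    by (simp_all add: osc_mult_assoc[symmetric] osc_mult_inverse osc_mult_zero)
      (simp_all add: osc_mult_assoc osc_mult_inverse osc_mult_zero)
  have "invariant_under (\<lambda>g. osc_mult lam a g) D" for a
  proof (rule invariant_under_christoffel[OF lin, where \<psi> = "\<lambda>g. osc_mult lam (osc_inverse lam a) g"])
    fix p u v :: "'a osc"
    show "frechet_derivative (\<lambda>q. frechet_derivative (\<lambda>g. osc_mult lam a g) (at q) v) (at p) u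
      + christoffel D (osc_mult lam a p) (frechet_derivative (\<lambda>g. osc_mult lam a g) (at p) u)
          (frechet_derivative (\<lambda>g. osc_mult lam a g) (at p) v)
      = frechet_derivative (\<lambda>g. osc_mult lam a g) (at p) (christoffel D p u v)"
      unfolding frechet_derivative_osc_mult_left \<Gamma>
      by (simp add: osc_christoffel_def Let_def osc_mult_eq
          osc_form_simps osc_gen_simps osc_rot_simps osc_rot_gen[symmetric] osc_form_rot
          algebra_simps add_divide_distrib)
  qed (intro smooth_osc_mult smooth_const smooth_ident inv)+
  moreover have "invariant_under (\<lambda>g. osc_mult lam g a) D" for a
  proof (rule invariant_under_christoffel[OF lin, where \<psi> = "\<lambda>g. osc_mult lam g (osc_inverse lam a)"])
    fix p u v :: "'a osc"
    define r where "r = osc_rot lam (fst p) (snd (snd a))"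
    note r = r_def[symmetric]
    have zero: "osc_form r (osc_gen lam (osc_gen lam r)) = 0"
      using osc_form_gen_gen[of r lam r] by simp
    \<comment> \<open>Of the two forms of the symmetric expression \<omega>(_, J _), the one with
      \<open>r\<close> under J is chosen, so that equal terms coincide.\<close>
    note commute = osc_form_gen_commute[of r lam "snd (snd u)"] osc_form_gen_commute[of r lam "snd (snd v)"]
    show "frechet_derivative (\<lambda>q. frechet_derivative (\<lambda>g. osc_mult lam g a) (at q) v) (at p) u
      + christoffel D (osc_mult lam p a) (frechet_derivative (\<lambda>g. osc_mult lam g a) (at p) u)
          (frechet_derivative (\<lambda>g. osc_mult lam g a) (at p) v)
      = frechet_derivative (\<lambda>g. osc_mult lam g a) (at p) (christoffel D p u v)"
      unfolding second_derivative_osc_mult_right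
      unfolding frechet_derivative_osc_mult_right \<Gamma>
      unfolding osc_mult_eq osc_christoffel_def Let_def fst_conv snd_conv r
        osc_gen_simps scaleR_add_right
      by (intro prod_eqI;
          simp only: fst_conv snd_conv fst_add snd_add osc_form_simps osc_form_gen osc_gen_simps
            scaleR_add_right commute zero)
        (simp, simp add: algebra_simps add_divide_distrib,
          rule euclidean_eqI, simp only: inner_simps, simp add: algebra_simps add_divide_distrib)
  qed (intro smooth_osc_mult smooth_const smooth_ident inv)+
  ultimately show ?thesis
    by (simp add: bi_invariant_def left_invariant_def right_invariant_def osc_group_def)
qed

section \<open>Holonomy\<close>

text \<open>\<open>fst (V t)\<close> is constant along parallel fields, and the correction term vanishes at the ends
  of a loop when \<open>r\<close> is the time coordinate of its base point; so both connections have the same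
  parallel transports around loops.\<close>

lemma parallel_along_osc_shift:
  assumes D: "osc_connection lam c D" and D': "osc_connection lam c' D'"
    and \<gamma>: "C1_segment \<gamma> a b" and V: "parallel_along D \<gamma> V a b"
  shows "parallel_along D' \<gamma> (\<lambda>t. V t + (0, (c - c') * (fst (\<gamma> t) - r) * fst (V t), 0)) a b"
  unfolding parallel_along_def
proof
  fix t assume t: "t \<in> {a..b}"
  let ?S = "at t within {a..b}"
  let ?g = "vector_derivative \<gamma> ?S"
  have \<Gamma>: "christoffel D = osc_christoffel lam c" "christoffel D' = osc_christoffel lam c'"
    using D D' by (auto simp: osc_connection_def)
  have V': "(V has_vector_derivative - osc_christoffel lam c (\<gamma> t) ?g (V t)) ?S"
    using V t by (simp add: parallel_along_def \<Gamma>)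
  have g': "(\<gamma> has_vector_derivative ?g) ?S"
    using \<gamma> t by (simp add: C1_segment_def vector_derivative_works)
  note fst' = bounded_linear.has_vector_derivative[OF bounded_linear_fst]
  have Vt: "((\<lambda>t. fst (V t)) has_real_derivative 0) ?S"
    using fst'[OF V'] by (simp add: has_real_derivative_iff_has_vector_derivative osc_christoffel_def Let_def)
  have gt: "((\<lambda>t. fst (\<gamma> t)) has_real_derivative fst ?g) ?S"
    using fst'[OF g'] by (simp add: has_real_derivative_iff_has_vector_derivative)
  have "((\<lambda>t. (c - c') * (fst (\<gamma> t) - r) * fst (V t)) has_real_derivative (c - c') * fst ?g * fst (V t)) ?S"
    by (auto intro!: derivative_eq_intros Vt gt)
  then have "((\<lambda>t. V t + (0, (c - c') * (fst (\<gamma> t) - r) * fst (V t), 0)) has_vector_derivative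
    - osc_christoffel lam c (\<gamma> t) ?g (V t) + (0, (c - c') * fst ?g * fst (V t), 0)) ?S"
    by (intro has_vector_derivative_add V' has_vector_derivative_Pair has_vector_derivative_const)
      (simp add: has_real_derivative_iff_has_vector_derivative)
  \<comment> \<open>The shift has neither a time nor a complex component, so it does not change the
    Christoffel term; its derivative is the difference of the terms with c and c'.\<close>
  then show "((\<lambda>t. V t + (0, (c - c') * (fst (\<gamma> t) - r) * fst (V t), 0)) has_vector_derivative
    - christoffel D' (\<gamma> t) ?g (V t + (0, (c - c') * (fst (\<gamma> t) - r) * fst (V t), 0))) ?S"
    by (rule has_vector_derivative_eq_rhs)
      (simp add: \<Gamma> osc_christoffel_def Let_def algebra_simps)
qed

text \<open>The loop, its partition and the endomorphism stay the same; only the parallel fields are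
  shifted. Since c and c' are arbitrary, exchanging them gives equality.\<close>

lemma holonomy_group_osc_subset:
  assumes D: "osc_connection lam c D" and D': "osc_connection lam c' D'"
  shows "holonomy_group D p \<subseteq> holonomy_group D' p"
proof
  fix P assume "P \<in> holonomy_group D p"
  then obtain \<gamma> m \<tau> where P: "linear P" and \<tau>: "unit_partition m \<tau>"
    and seg: "\<And>i. i < m \<Longrightarrow> C1_segment \<gamma> (\<tau> i) (\<tau> (Suc i))" and loop: "\<gamma> 0 = p" "\<gamma> 1 = p"
    and ex: "\<And>v. \<exists>V. V 0 = v \<and> V 1 = P v \<and> (\<forall>i<m. parallel_along D \<gamma> V (\<tau> i) (\<tau> (Suc i)))"
    unfolding holonomy_group_def by blast
  have "\<exists>V. V 0 = v \<and> V 1 = P v \<and> (\<forall>i<m. parallel_along D' \<gamma> V (\<tau> i) (\<tau> (Suc i)))" for v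
  proof -
    obtain V where V: "V 0 = v" "V 1 = P v" "\<And>i. i < m \<Longrightarrow> parallel_along D \<gamma> V (\<tau> i) (\<tau> (Suc i))"
      using ex by blast
    then show ?thesis
      using parallel_along_osc_shift[OF D D' seg V(3), where r = "fst p"]
      by (intro exI[of _ "\<lambda>t. V t + (0, (c - c') * (fst (\<gamma> t) - fst p) * fst (V t), 0)"])
        (auto simp: loop zero_prod_def[symmetric])
  qed
  with P \<tau> seg loop show "P \<in> holonomy_group D' p"
    unfolding holonomy_group_def by blast
qed

section \<open>The product on the Lie algebra and the coordinate fields\<close>

lemma Basis_subset_osc_basis: "(Basis :: 'n::finite osc set) \<subseteq> osc_basis"
  by (auto simp: Basis_prod_def Basis_vec_def Basis_complex_def osc_basis_def e_m1_def e_0_def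
      e_re_def e_im_def zero_prod_def)

text \<open>Expanding both arguments in \<open>Basis\<close> leaves the single pair
  \<open>(e_m1, e_m1)\<close>, whose coefficients are the time components.\<close>

lemma circ_eq:
  fixes circ :: "'n::finite osc \<Rightarrow> 'n osc \<Rightarrow> 'n osc"
  assumes bil: "bilinear circ" and em1: "circ e_m1 e_m1 = c *\<^sub>R e_0"
    and other: "\<And>a b. a \<in> osc_basis \<Longrightarrow> b \<in> osc_basis \<Longrightarrow> (a, b) \<noteq> (e_m1, e_m1) \<Longrightarrow> circ a b = 0"
  shows "circ u v = (0, c * fst u * fst v, 0)"
proof -
  have B: "b \<in> Basis \<Longrightarrow> b \<in> osc_basis" for b :: "'n osc"
    using Basis_subset_osc_basis by blast
  have em1_Basis: "(e_m1 :: 'n osc) \<in> Basis"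
    by (auto simp: e_m1_def Basis_prod_def zero_prod_def)
  have l: "linear (\<lambda>u. circ u v)" "linear (circ u)" for u v
    using bil unfolding bilinear_def by blast+
  have em1_right: "circ e_m1 v = (v \<bullet> e_m1) *\<^sub>R c *\<^sub>R e_0"
  proof -
    have "circ e_m1 v = (\<Sum>b\<in>Basis. (v \<bullet> b) *\<^sub>R circ e_m1 b)"
      by (rule linear_Basis_expansion[OF l(2)])
    also have "\<dots> = (\<Sum>b\<in>{e_m1}. (v \<bullet> b) *\<^sub>R circ e_m1 b)"
      by (rule sum.mono_neutral_right) (auto simp: em1_Basis B other)
    finally show ?thesis by (simp add: em1)
  qed
  have zero: "circ b v = 0" if "b \<in> Basis" "b \<noteq> e_m1" for b
    using that by (subst linear_Basis_expansion[OF l(2)]) (simp add: B other)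
  have "circ u v = (\<Sum>b\<in>Basis. (u \<bullet> b) *\<^sub>R circ b v)"
    by (rule linear_Basis_expansion[OF l(1)])
  also have "\<dots> = (\<Sum>b\<in>{e_m1}. (u \<bullet> b) *\<^sub>R circ b v)"
    by (rule sum.mono_neutral_right) (auto simp: em1_Basis zero)
  finally have "circ u v = (u \<bullet> e_m1) *\<^sub>R (v \<bullet> e_m1) *\<^sub>R c *\<^sub>R e_0"
    by (simp add: em1_right)
  then show ?thesis by (simp add: e_m1_def e_0_def inner_prod_def)
qed

lemma osc_gen_axis: "osc_gen lam (axis j z) = axis j (\<i> * complex_of_real (lam $ j) * z)"
  by (simp add: osc_gen_def vec_eq_iff axis_def)

lemma osc_form_axis: "osc_form z (axis j w) = Im (cnj (z $ j) * w)"
proof -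
  have "osc_form z (axis j w) = (\<Sum>k\<in>UNIV. if k = j then Im (cnj (z $ k) * w) else 0)"
    unfolding osc_form_def by (rule sum.cong) (auto simp: axis_def)
  then show ?thesis by simp
qed

theorem mainTheorem3:
  fixes lam :: "real ^ 'n::{finite,linorder}"
    and c :: real
    and circ :: "'n osc \<Rightarrow> 'n osc \<Rightarrow> 'n osc"
    and nabla0 nabla :: "('n osc) connection"
  assumes lam_pos: "\<And>j. 0 < lam $ j"
    and lam_mono: "\<And>i j. i \<le> j \<Longrightarrow> lam $ i \<le> lam $ j"
    and circ_bilinear: "bilinear circ"
    and circ_em1: "circ e_m1 e_m1 = c *\<^sub>R e_0"
    and circ_other: "\<And>a b. a \<in> osc_basis \<Longrightarrow> b \<in> osc_basis \<Longrightarrow> (a, b) \<noteq> (e_m1, e_m1) \<Longrightarrow> circ a b = 0"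
    and conn0: "linear_connection nabla0"
    and conn: "linear_connection nabla"
    and nabla0: "\<And>u v. nabla0 (left_inv_field (osc_group lam) u) (left_inv_field (osc_group lam) v) =
          (\<lambda>p. (1/2) *\<^sub>R vf_bracket (left_inv_field (osc_group lam) u) (left_inv_field (osc_group lam) v) p)"
    and nabla: "\<And>u v. nabla (left_inv_field (osc_group lam) u) (left_inv_field (osc_group lam) v) =
          (\<lambda>p. nabla0 (left_inv_field (osc_group lam) u) (left_inv_field (osc_group lam) v) p
                + left_inv_field (osc_group lam) (circ u v) p)"
  shows "bi_invariant (osc_group lam) nabla
    \<and> locally_symmetric nabla
    \<and> same_curvature nabla nabla0
    \<and> (\<forall>p. holonomy_algebra nabla p = holonomy_algebra nabla0 p)
    \<and> (\<forall>j. nabla d_t (d_x j) =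
              (\<lambda>p. - (lam $ j / 2) *\<^sub>R ((1/2 * x_coord j p) *\<^sub>R d_s p + d_y j p))
         \<and> nabla (d_x j) d_t =
              (\<lambda>p. - (lam $ j / 2) *\<^sub>R ((1/2 * x_coord j p) *\<^sub>R d_s p + d_y j p))
         \<and> nabla d_t (d_y j) =
              (\<lambda>p. - (lam $ j / 2) *\<^sub>R ((1/2 * y_coord j p) *\<^sub>R d_s p - d_x j p))
         \<and> nabla (d_y j) d_t =
              (\<lambda>p. - (lam $ j / 2) *\<^sub>R ((1/2 * y_coord j p) *\<^sub>R d_s p - d_x j p)))
    \<and> nabla d_t d_t = (\<lambda>p. c *\<^sub>R d_s p)
    \<and> (\<forall>X\<in>coord_fields. \<forall>Y\<in>coord_fields.
          (X, Y) \<notin> {(d_t, d_t)} \<union> (\<Union>j. {(d_t, d_x j), (d_x j, d_t), (d_t, d_y j), (d_y j, d_t)})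
          \<longrightarrow> nabla X Y = (\<lambda>p. 0))"
proof -
  let ?L = "left_inv_field (osc_group lam)"
  have circ: "circ u v = (0, c * fst u * fst v, 0)" for u v
    using circ_bilinear circ_em1 circ_other by (rule circ_eq)
  \<comment> \<open>The values of \<open>circ\<close> are multiples of \<open>e_0\<close>, whose
    left invariant field is constant in the chart.\<close>
  have "?L (circ u v) = (\<lambda>p. (0, c * fst u * fst v, 0))" for u v
    by (simp add: circ left_inv_field_osc osc_rot_simps osc_form_simps)
  then have D: "osc_connection lam c nabla"
    by (intro osc_connectionI[OF conn]) (simp add: nabla nabla0)
  have D0: "osc_connection lam 0 nabla0"
    by (intro osc_connectionI[OF conn0]) (simp add: nabla0 zero_prod_def[symmetric])
  have curv: "same_curvature nabla nabla0"
    unfolding same_curvature_def using curvature_osc[OF D] curvature_osc[OF D0] by (simp add: fun_eq_iff)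
  \<comment> \<open>The algebra depends on the connection only through the holonomy group, so the
    two inclusions of groups suffice.\<close>
  have hol: "holonomy_algebra nabla p = holonomy_algebra nabla0 p" for p
    using holonomy_group_osc_subset[OF D D0] holonomy_group_osc_subset[OF D0 D]
    unfolding holonomy_algebra_def by blast
  \<comment> \<open>On constant fields the operator is its own Christoffel symbol, so the coordinate
    formulas are values of \<open>osc_christoffel\<close> at basis vectors.\<close>
  have \<Gamma>: "nabla (\<lambda>p. u) (\<lambda>p. v) = (\<lambda>p. osc_christoffel lam c p u v)" for u v
    using D by (metis osc_connection_def christoffel_def)
  note coord_simps = \<Gamma> osc_christoffel_def Let_def d_t_def d_s_def d_x_def d_y_def
    e_m1_def e_0_def e_re_def e_im_def osc_gen_simps osc_form_simps osc_gen_axis osc_form_axis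
  have vanish: "nabla d_t d_s = (\<lambda>p. 0)" "nabla d_s d_t = (\<lambda>p. 0)" "nabla d_s d_s = (\<lambda>p. 0)"
    "nabla d_s (d_x j) = (\<lambda>p. 0)" "nabla (d_x j) d_s = (\<lambda>p. 0)"
    "nabla d_s (d_y j) = (\<lambda>p. 0)" "nabla (d_y j) d_s = (\<lambda>p. 0)"
    "nabla (d_x i) (d_x j) = (\<lambda>p. 0)" "nabla (d_x i) (d_y j) = (\<lambda>p. 0)"
    "nabla (d_y i) (d_x j) = (\<lambda>p. 0)" "nabla (d_y i) (d_y j) = (\<lambda>p. 0)" for i j
    by (simp_all add: coord_simps zero_prod_def)
  have scale_axis: "r *\<^sub>R axis j z = axis j (r *\<^sub>R z)" "- axis j z = axis j (- z)" for r :: real and j :: 'n and z :: complex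
    by (simp_all add: vec_eq_iff axis_def)
  have "nabla d_t (d_x j) = (\<lambda>p. - (lam $ j / 2) *\<^sub>R ((1/2 * x_coord j p) *\<^sub>R d_s p + d_y j p))"
    "nabla (d_x j) d_t = (\<lambda>p. - (lam $ j / 2) *\<^sub>R ((1/2 * x_coord j p) *\<^sub>R d_s p + d_y j p))"
    "nabla d_t (d_y j) = (\<lambda>p. - (lam $ j / 2) *\<^sub>R ((1/2 * y_coord j p) *\<^sub>R d_s p - d_x j p))"
    "nabla (d_y j) d_t = (\<lambda>p. - (lam $ j / 2) *\<^sub>R ((1/2 * y_coord j p) *\<^sub>R d_s p - d_x j p))"
    "nabla d_t d_t = (\<lambda>p. c *\<^sub>R d_s p)" for j
    by (auto simp: coord_simps x_coord_def y_coord_def split_beta scale_axis fun_eq_iff complex_eq_iff axis_eq_axis)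
  moreover have "\<forall>X\<in>coord_fields. \<forall>Y\<in>coord_fields.
      (X, Y) \<notin> {(d_t, d_t)} \<union> (\<Union>j. {(d_t, d_x j), (d_x j, d_t), (d_t, d_y j), (d_y j, d_t)})
      \<longrightarrow> nabla X Y = (\<lambda>p. 0)"
    by (auto simp: coord_fields_def vanish)
  ultimately show ?thesis
    using curv hol bi_invariant_osc[OF D] torsion_free_osc[OF D] parallel_curvature_osc[OF D]
    unfolding locally_symmetric_def by blast
qed

end
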